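(* Let $\Omega$ be an arbitrary index set. For a linear functional $L : A_\Omega \rightarrow \mathbb{R}$ the following are equivalent: (1) $L$ is a positive linear functional, i.e. $L(f)\ge 0$ for every $f\in A_\Omega$ with $f(\alpha)\ge 0$ for all $\alpha\in\mathbb{R}^\Omega$. (2) $L$ extends to a positive (equivalently, PSD) linear functional $L : B_\Omega \rightarrow \mathbb{R}$. (3) For all $f\in A_\Omega$ and all $p$ of the form $p= \prod_{k=1}^n (1+x_{i_k}^2)^{\ell_k}$, where $x_{i_1},\dots,x_{i_n}$ are the variables appearing in $f$ and $\ell_k \ge 0$ are integers, $k=1,\dots,n$, one has: $pf \in \sum A_\Omega^2$ implies $L(f)\ge 0$.
   Context: $A_\Omega=\mathbb{R}[x_i\mid i\in\Omega]$ is the polynomial algebra in the variables $x_i$, $i\in\Omega$, and $B_\Omega=\mathbb{R}[x_i,\frac{1}{1+x_i^2}\mid i\in\Omega]$ is the localization of $A_\Omega$ at the multiplicative set generated by the elements $1+x_i^2$, $i\in\Omega$. Elements of $A_\Omega$ and $B_\Omega$ are viewed as functions on $\mathbb{R}^\Omega$ by evaluation. For a commutative $\mathbb{R}$-algebra $D$, $\sum D^2$ denotes the set of finite sums of squares of elements of $D$; a linear functional $L:D\to\mathbb{R}$ is positive semidefinite (PSD) if $L(\sum D^2)\subseteq[0,\infty)$. For $D=A_\Omega$ or $B_\Omega$, $L$ is positive if $L(f)\ge 0$ for every $f\in D$ that is $\ge 0$ at every point of $\mathbb{R}^\Omega$. (For $D=B_\Omega$ positive and PSD are equivalent.) *)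

theory Defs
  imports "HOL-Analysis.Analysis" "HOL-Analysis.Finite_Function_Topology"
begin

section \<open>Polynomials\<close>

text \<open>A monomial is a finitely supported exponent vector, a polynomial a finitely supported
  family of real coefficients indexed by monomials.  The index set of the variables is a subset
  \<open>\<Omega>\<close> of the type \<open>'i\<close>, so that the case \<open>\<Omega> = {}\<close> is covered.\<close>

type_synonym 'i mpoly = "('i \<Rightarrow>\<^sub>0 nat) \<Rightarrow>\<^sub>0 real"

definition Var :: "'i \<Rightarrow> 'i mpoly" where
  "Var i = Poly_Mapping.single (Poly_Mapping.single i 1) 1"

definition vars :: "'i mpoly \<Rightarrow> 'i set" where
  "vars f = (\<Union>m \<in> Poly_Mapping.keys f. Poly_Mapping.keys m)"

definition A_alg :: "'i set \<Rightarrow> 'i mpoly set" where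
  "A_alg \<Omega> = {f. vars f \<subseteq> \<Omega>}"

definition monom_eval :: "('i \<Rightarrow> real) \<Rightarrow> ('i \<Rightarrow>\<^sub>0 nat) \<Rightarrow> real" where
  "monom_eval \<alpha> m = (\<Prod>i \<in> Poly_Mapping.keys m. \<alpha> i ^ Poly_Mapping.lookup m i)"

definition A_eval :: "('i \<Rightarrow> real) \<Rightarrow> 'i mpoly \<Rightarrow> real" where
  "A_eval \<alpha> f = (\<Sum>m \<in> Poly_Mapping.keys f. Poly_Mapping.lookup f m * monom_eval \<alpha> m)"

lemma poly_mapping_sum_single:
  fixes f :: "'a \<Rightarrow>\<^sub>0 'b::comm_monoid_add"
  shows "f = (\<Sum>m \<in> Poly_Mapping.keys f. Poly_Mapping.single m (Poly_Mapping.lookup f m))"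
  by (rule poly_mapping_eqI)
     (auto simp: lookup_sum lookup_single when_def in_keys_iff sum.delta' if_distrib cong: if_cong)

lemma scaleR_poly_mapping_eq: 
  fixes f :: "'i mpoly"
  shows "c *\<^sub>R f = Poly_Mapping.single 0 c * f"
proof (rule poly_mapping_eqI)
  fix m
  have fin: "finite {i. c *\<^sub>R Poly_Mapping.lookup f i \<noteq> 0}"
    by (rule finite_subset[OF _ finite_keys[of f]]) (auto simp: in_keys_iff)
  have "Poly_Mapping.single 0 c * f = Poly_Mapping.map ((*) c) f"
    by (simp add: mult_map_scale_conv_mult)
  then show "Poly_Mapping.lookup (c *\<^sub>R f) m = Poly_Mapping.lookup (Poly_Mapping.single 0 c * f) m"
    using fin by (simp add: scaleR_poly_mapping_def map.rep_eq when_def)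
qed

lemma monom_eval_superset:
  assumes "finite K" "Poly_Mapping.keys m \<subseteq> K"
  shows "monom_eval \<alpha> m = (\<Prod>i \<in> K. \<alpha> i ^ Poly_Mapping.lookup m i)"
  unfolding monom_eval_def
  by (rule prod.mono_neutral_left) (use assms in \<open>auto simp: in_keys_iff\<close>)

lemma monom_eval_add: "monom_eval \<alpha> (m + n) = monom_eval \<alpha> m * monom_eval \<alpha> n"
proof -
  let ?K = "Poly_Mapping.keys m \<union> Poly_Mapping.keys n"
  have "Poly_Mapping.keys (m + n) \<subseteq> ?K" by (rule keys_add)
  then show ?thesis
    by (simp add: monom_eval_superset[of ?K] lookup_add power_add prod.distrib)
qed

lemma A_eval_superset:
  assumes "finite K" "Poly_Mapping.keys f \<subseteq> K"
  shows "A_eval \<alpha> f = (\<Sum>m \<in> K. Poly_Mapping.lookup f m * monom_eval \<alpha> m)"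
  unfolding A_eval_def
  by (rule sum.mono_neutral_left) (use assms in \<open>auto simp: in_keys_iff\<close>)

lemma A_eval_add: "A_eval \<alpha> (f + g) = A_eval \<alpha> f + A_eval \<alpha> g"
proof -
  let ?K = "Poly_Mapping.keys f \<union> Poly_Mapping.keys g"
  have "Poly_Mapping.keys (f + g) \<subseteq> ?K" by (rule keys_add)
  then show ?thesis
    by (simp add: A_eval_superset[of ?K] lookup_add distrib_right sum.distrib)
qed

lemma A_eval_zero [simp]: "A_eval \<alpha> 0 = 0"
  by (simp add: A_eval_def)

lemma A_eval_sum: "A_eval \<alpha> (sum g K) = (\<Sum>k\<in>K. A_eval \<alpha> (g k))"
  by (induction K rule: infinite_finite_induct) (auto simp: A_eval_add)

lemma A_eval_single: "A_eval \<alpha> (Poly_Mapping.single m c) = c * monom_eval \<alpha> m"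
  by (simp add: A_eval_def)

lemma A_eval_mult: "A_eval \<alpha> (f * g) = A_eval \<alpha> f * A_eval \<alpha> g"
proof -
  let ?s = "\<lambda>f m. Poly_Mapping.single m (Poly_Mapping.lookup f m)"
  have "f * g = (\<Sum>m \<in> Poly_Mapping.keys f. \<Sum>n \<in> Poly_Mapping.keys g. ?s f m * ?s g n)"
    by (subst poly_mapping_sum_single[of f], subst poly_mapping_sum_single[of g])
       (rule sum_product)
  also have "A_eval \<alpha> \<dots> = (\<Sum>m \<in> Poly_Mapping.keys f. \<Sum>n \<in> Poly_Mapping.keys g.
      (Poly_Mapping.lookup f m * monom_eval \<alpha> m) * (Poly_Mapping.lookup g n * monom_eval \<alpha> n))"
    by (simp add: A_eval_sum mult_single A_eval_single monom_eval_add mult_ac)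
  also have "\<dots> = A_eval \<alpha> f * A_eval \<alpha> g"
    unfolding A_eval_def by (rule sum_product [symmetric])
  finally show ?thesis .
qed

lemma A_eval_one [simp]: "A_eval \<alpha> 1 = 1"
  using A_eval_single[of \<alpha> 0 1] by (simp add: monom_eval_def)

lemma A_eval_Var [simp]: "A_eval \<alpha> (Var i) = \<alpha> i"
  by (simp add: Var_def A_eval_single monom_eval_def)

lemma A_eval_scaleR: "A_eval \<alpha> (c *\<^sub>R f) = c * A_eval \<alpha> f"
  by (simp add: scaleR_poly_mapping_eq A_eval_mult A_eval_single monom_eval_def)

lemma A_eval_uminus: "A_eval \<alpha> (- f) = - A_eval \<alpha> f"
  using A_eval_scaleR[of \<alpha> "-1" f] by simp


section \<open>Localization at the elements \<open>1 + x\<^sub>i\<^sup>2\<close>\<close>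

inductive_set denoms :: "'i set \<Rightarrow> 'i mpoly set" for \<Omega> :: "'i set" where
  one: "1 \<in> denoms \<Omega>"
| step: "s \<in> denoms \<Omega> \<Longrightarrow> i \<in> \<Omega> \<Longrightarrow> (1 + Var i ^ 2) * s \<in> denoms \<Omega>"

lemma denoms_mult: "s \<in> denoms \<Omega> \<Longrightarrow> t \<in> denoms \<Omega> \<Longrightarrow> s * t \<in> denoms \<Omega>"
  by (induction rule: denoms.induct) (auto simp: mult.assoc intro: denoms.step)

lemma denoms_mono: "\<Omega> \<subseteq> \<Omega>' \<Longrightarrow> denoms \<Omega> \<subseteq> denoms \<Omega>'"
  by (rule subsetI, erule denoms.induct) (auto intro: denoms.intros)

lemma A_eval_denoms_pos: "s \<in> denoms \<Omega> \<Longrightarrow> A_eval \<alpha> s > 0"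
proof (induction rule: denoms.induct)
  case (step s i)
  have "A_eval \<alpha> (1 + Var i ^ 2) = 1 + (\<alpha> i)\<^sup>2"
    by (simp add: A_eval_add A_eval_mult power2_eq_square)
  then show ?case using step by (simp add: A_eval_mult add_pos_nonneg)
qed simp

definition loc_rel :: "'i mpoly \<times> 'i mpoly \<Rightarrow> 'i mpoly \<times> 'i mpoly \<Rightarrow> bool" where
  "loc_rel = (\<lambda>(f, s) (g, t). s \<in> denoms UNIV \<and> t \<in> denoms UNIV \<and>
     (\<exists>u \<in> denoms UNIV. u * (f * t - g * s) = 0))"

lemma loc_relI:
  assumes "s \<in> denoms UNIV" "t \<in> denoms UNIV" "f * t = g * s"
  shows "loc_rel (f, s) (g, t)"
  using assms by (auto simp: loc_rel_def intro!: bexI[of _ 1] denoms.one)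

lemma part_equivp_loc_rel: "part_equivp (loc_rel :: 'i mpoly \<times> 'i mpoly \<Rightarrow> _)"
proof (rule part_equivpI)
  show "\<exists>x. loc_rel x (x :: 'i mpoly \<times> 'i mpoly)"
    by (rule exI[of _ "(0, 1)"]) (simp add: loc_relI denoms.one)
  show "symp (loc_rel :: 'i mpoly \<times> 'i mpoly \<Rightarrow> _)"
  proof (rule sympI, clarify)
    fix f s g t :: "'i mpoly"
    assume "loc_rel (f, s) (g, t)"
    then obtain u where u: "s \<in> denoms UNIV" "t \<in> denoms UNIV" "u \<in> denoms UNIV"
      "u * (f * t - g * s) = 0" by (auto simp: loc_rel_def)
    have "u * (g * s - f * t) = - (u * (f * t - g * s))" by (simp add: algebra_simps)
    then show "loc_rel (g, t) (f, s)" using u by (auto simp: loc_rel_def)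
  qed
  show "transp (loc_rel :: 'i mpoly \<times> 'i mpoly \<Rightarrow> _)"
  proof (rule transpI, clarify)
    fix f s g t h r :: "'i mpoly"
    assume "loc_rel (f, s) (g, t)" "loc_rel (g, t) (h, r)"
    then obtain u v where uv: "s \<in> denoms UNIV" "t \<in> denoms UNIV" "r \<in> denoms UNIV"
      "u \<in> denoms UNIV" "v \<in> denoms UNIV"
      "u * (f * t - g * s) = 0" "v * (g * r - h * t) = 0"
      by (auto simp: loc_rel_def)
    have "(t * (u * v)) * (f * r - h * s)
        = v * r * (u * (f * t - g * s)) + u * s * (v * (g * r - h * t))"
      by (simp add: algebra_simps)
    then have "(t * (u * v)) * (f * r - h * s) = 0" by (simp only: uv(6,7)) simp
    moreover have "t * (u * v) \<in> denoms UNIV" using uv by (intro denoms_mult)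
    ultimately show "loc_rel (f, s) (h, r)" using uv by (auto simp: loc_rel_def)
  qed
qed

quotient_type 'i mfrac = "'i mpoly \<times> 'i mpoly" / partial: loc_rel
  by (rule part_equivp_loc_rel)

text \<open>Only meaningful for \<open>s \<in> denoms UNIV\<close>.\<close>

definition frac :: "'i mpoly \<Rightarrow> 'i mpoly \<Rightarrow> 'i mfrac" where
  "frac f s = abs_mfrac (f, s)"

instantiation mfrac :: (type) "{comm_ring_1, real_algebra_1}"
begin

lift_definition zero_mfrac :: "'a mfrac" is "(0, 1)"
  by (simp add: loc_relI denoms.one)

lift_definition one_mfrac :: "'a mfrac" is "(1, 1)"
  by (simp add: loc_relI denoms.one)

lift_definition plus_mfrac :: "'a mfrac \<Rightarrow> 'a mfrac \<Rightarrow> 'a mfrac"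
  is "\<lambda>(f, s) (g, t). (f * t + g * s, s * t)"
proof (clarify)
  fix f s f' s' g t g' t' :: "'a mpoly"
  assume "loc_rel (f, s) (f', s')" "loc_rel (g, t) (g', t')"
  then obtain u v where uv: "s \<in> denoms UNIV" "s' \<in> denoms UNIV" "t \<in> denoms UNIV"
      "t' \<in> denoms UNIV" "u \<in> denoms UNIV" "v \<in> denoms UNIV"
      "u * (f * s' - f' * s) = 0" "v * (g * t' - g' * t) = 0"
    by (auto simp: loc_rel_def)
  have "(u * v) * ((f * t + g * s) * (s' * t') - (f' * t' + g' * s') * (s * t))
     = v * t * t' * (u * (f * s' - f' * s)) + u * s * s' * (v * (g * t' - g' * t))"
    by (simp add: algebra_simps)
  then have "(u * v) * ((f * t + g * s) * (s' * t') - (f' * t' + g' * s') * (s * t)) = 0"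
    by (simp only: uv(7,8)) simp
  then show "loc_rel (f * t + g * s, s * t) (f' * t' + g' * s', s' * t')"
    using uv denoms_mult by (fastforce simp: loc_rel_def)
qed

lift_definition times_mfrac :: "'a mfrac \<Rightarrow> 'a mfrac \<Rightarrow> 'a mfrac"
  is "\<lambda>(f, s) (g, t). (f * g, s * t)"
proof (clarify)
  fix f s f' s' g t g' t' :: "'a mpoly"
  assume "loc_rel (f, s) (f', s')" "loc_rel (g, t) (g', t')"
  then obtain u v where uv: "s \<in> denoms UNIV" "s' \<in> denoms UNIV" "t \<in> denoms UNIV"
      "t' \<in> denoms UNIV" "u \<in> denoms UNIV" "v \<in> denoms UNIV"
      "u * (f * s' - f' * s) = 0" "v * (g * t' - g' * t) = 0"
    by (auto simp: loc_rel_def)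
  have "(u * v) * ((f * g) * (s' * t') - (f' * g') * (s * t))
     = v * g * t' * (u * (f * s' - f' * s)) + u * s * f' * (v * (g * t' - g' * t))"
    by (simp add: algebra_simps)
  then have "(u * v) * ((f * g) * (s' * t') - (f' * g') * (s * t)) = 0"
    by (simp only: uv(7,8)) simp
  then show "loc_rel (f * g, s * t) (f' * g', s' * t')"
    using uv denoms_mult by (fastforce simp: loc_rel_def)
qed

lift_definition uminus_mfrac :: "'a mfrac \<Rightarrow> 'a mfrac" is "\<lambda>(f, s). (- f, s)"
proof (clarify)
  fix f s f' s' :: "'a mpoly"
  assume "loc_rel (f, s) (f', s')"
  then obtain u where u: "s \<in> denoms UNIV" "s' \<in> denoms UNIV" "u \<in> denoms UNIV"
      "u * (f * s' - f' * s) = 0"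
    by (auto simp: loc_rel_def)
  have "u * ((- f) * s' - (- f') * s) = - (u * (f * s' - f' * s))"
    by (simp add: algebra_simps)
  then have "u * ((- f) * s' - (- f') * s) = 0" by (simp only: u(4)) simp
  then show "loc_rel (- f, s) (- f', s')"
    using u unfolding loc_rel_def by blast
qed

definition minus_mfrac :: "'a mfrac \<Rightarrow> 'a mfrac \<Rightarrow> 'a mfrac" where
  "minus_mfrac x y = x + - y"

lift_definition scaleR_mfrac :: "real \<Rightarrow> 'a mfrac \<Rightarrow> 'a mfrac" is "\<lambda>c (f, s). (c *\<^sub>R f, s)"
proof (clarify)
  fix c :: real and f s f' s' :: "'a mpoly"
  assume "loc_rel (f, s) (f', s')"
  then obtain u where u: "s \<in> denoms UNIV" "s' \<in> denoms UNIV" "u \<in> denoms UNIV"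
      "u * (f * s' - f' * s) = 0"
    by (auto simp: loc_rel_def)
  have "u * ((c *\<^sub>R f) * s' - (c *\<^sub>R f') * s)
      = Poly_Mapping.single 0 c * (u * (f * s' - f' * s))"
    by (simp add: algebra_simps scaleR_poly_mapping_eq)
  then have "u * ((c *\<^sub>R f) * s' - (c *\<^sub>R f') * s) = 0" by (simp only: u(4)) simp
  then show "loc_rel (c *\<^sub>R f, s) (c *\<^sub>R f', s')"
    using u unfolding loc_rel_def by blast
qed

lemma loc_rel_refl_iff: "loc_rel (f, s) (f, s) \<longleftrightarrow> s \<in> denoms UNIV"
  by (auto simp: loc_rel_def intro: denoms.one)

lemmas denoms_ring = loc_relI denoms_mult denoms.one

instance
proof
  fix a b c :: "'a mfrac" and x y :: real
  show "a + b + c = a + (b + c)"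
    by transfer (auto simp: loc_rel_refl_iff algebra_simps intro!: denoms_ring)
  show "a + b = b + a"
    by transfer (auto simp: loc_rel_refl_iff algebra_simps intro!: denoms_ring)
  show "0 + a = a"
    by transfer (auto simp: loc_rel_refl_iff algebra_simps intro!: denoms_ring)
  show "- a + a = 0"
    by transfer (auto simp: loc_rel_refl_iff algebra_simps intro!: denoms_ring)
  show "a - b = a + - b"
    by (simp add: minus_mfrac_def)
  show "a * b * c = a * (b * c)"
    by transfer (auto simp: loc_rel_refl_iff algebra_simps intro!: denoms_ring)
  show "a * b = b * a"
    by transfer (auto simp: loc_rel_refl_iff algebra_simps intro!: denoms_ring)
  show "1 * a = a"
    by transfer (auto simp: loc_rel_refl_iff algebra_simps intro!: denoms_ring)
  show "(a + b) * c = a * c + b * c"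
    by transfer (auto simp: loc_rel_refl_iff algebra_simps intro!: denoms_ring)
  show "a * (b + c) = a * b + a * c"
    by transfer (auto simp: loc_rel_refl_iff algebra_simps intro!: denoms_ring)
  show "a * 1 = a"
    by transfer (auto simp: loc_rel_refl_iff algebra_simps intro!: denoms_ring)
  show "(0 :: 'a mfrac) \<noteq> 1"
  proof transfer
    have "u \<noteq> 0" if "u \<in> denoms UNIV" for u :: "'a mpoly"
      using A_eval_denoms_pos[OF that, of "\<lambda>_. 0"] by auto
    then show "\<not> loc_rel (0, 1) (1 :: 'a mpoly, 1)"
      by (auto simp: loc_rel_def)
  qed
  show "x *\<^sub>R (a + b) = x *\<^sub>R a + x *\<^sub>R b"
    by transfer (auto simp: loc_rel_refl_iff scaleR_poly_mapping_eq algebra_simps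
        intro!: denoms_ring)
  show "(x + y) *\<^sub>R a = x *\<^sub>R a + y *\<^sub>R a"
    by transfer (auto simp: loc_rel_refl_iff scaleR_poly_mapping_eq single_add algebra_simps
        intro!: denoms_ring)
  show "x *\<^sub>R y *\<^sub>R a = (x * y) *\<^sub>R a"
    by transfer (auto simp: loc_rel_refl_iff intro!: denoms_ring)
  show "1 *\<^sub>R a = a"
    by transfer (auto simp: loc_rel_refl_iff intro!: denoms_ring)
  show "x *\<^sub>R a * b = x *\<^sub>R (a * b)"
    by transfer (auto simp: loc_rel_refl_iff scaleR_poly_mapping_eq algebra_simps
        intro!: denoms_ring)
  show "a * x *\<^sub>R b = x *\<^sub>R (a * b)"
    by transfer (auto simp: loc_rel_refl_iff scaleR_poly_mapping_eq algebra_simps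
        intro!: denoms_ring)
qed

end

text \<open>\<open>B_alg UNIV\<close> is the localization of \<open>A_alg UNIV\<close> at \<open>denoms UNIV\<close>; for general \<open>\<Omega>\<close>,
  \<open>B_alg \<Omega>\<close> is the localization of \<open>A_alg \<Omega>\<close> at \<open>denoms \<Omega>\<close>, realised inside it.  By
  \<open>frac_eq_iff_local\<close> below, two fractions over \<open>\<Omega>\<close> are identified precisely when they agree in
  the localization of \<open>A_alg \<Omega>\<close> at \<open>denoms \<Omega>\<close>.\<close>

definition B_alg :: "'i set \<Rightarrow> 'i mfrac set" where
  "B_alg \<Omega> = {frac f s | f s. f \<in> A_alg \<Omega> \<and> s \<in> denoms \<Omega>}"

definition A_to_B :: "'i mpoly \<Rightarrow> 'i mfrac" where
  "A_to_B f = frac f 1"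

lemma one_plus_Var_sq_nonzerodivisor:
  fixes h :: "'i mpoly"
  assumes "(1 + Var i ^ 2) * h = 0"
  shows "h = 0"
proof (rule ccontr)
  assume "h \<noteq> 0"
  let ?e = "\<lambda>m. Poly_Mapping.lookup m i"
  let ?k = "Poly_Mapping.single i (2::nat)"
  have ne: "Poly_Mapping.keys h \<noteq> {}" using \<open>h \<noteq> 0\<close> by simp
  define M where "M = Max (?e ` Poly_Mapping.keys h)"
  have "M \<in> ?e ` Poly_Mapping.keys h" unfolding M_def using ne by (intro Max_in) auto
  then obtain m where m: "m \<in> Poly_Mapping.keys h" "?e m = M" by auto
  have max: "?e n \<le> M" if "n \<in> Poly_Mapping.keys h" for n
    unfolding M_def using that by (intro Max_ge) auto
  have "Poly_Mapping.single i (1::nat) + Poly_Mapping.single i 1 = ?k"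
    by (metis one_add_one single_add)
  then have V: "Var i ^ 2 = Poly_Mapping.single ?k (1::real)"
    by (simp only: Var_def power2_eq_square mult_single mult_1)
  have shift: "Poly_Mapping.lookup (Poly_Mapping.single ?k 1 * h) (?k + m)
      = Poly_Mapping.lookup h m"
  proof -
    have "Poly_Mapping.single ?k 1 * h = (\<Sum>n \<in> Poly_Mapping.keys h.
        Poly_Mapping.single (?k + n) (Poly_Mapping.lookup h n))"
      by (subst poly_mapping_sum_single[of h]) (simp add: sum_distrib_left mult_single)
    then show ?thesis
      by (simp add: lookup_sum lookup_single when_def in_keys_iff)
  qed
  have "?k + m \<notin> Poly_Mapping.keys h"
    using max[of "?k + m"] m(2) by (auto simp: lookup_add)
  then have "Poly_Mapping.lookup h (?k + m) = 0" by (simp add: in_keys_iff)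
  then have "Poly_Mapping.lookup ((1 + Var i ^ 2) * h) (?k + m) = Poly_Mapping.lookup h m"
    by (simp add: V distrib_right lookup_add shift)
  then show False using assms m(1) by (simp add: in_keys_iff)
qed

lemma denoms_nonzerodivisor:
  assumes "u \<in> denoms \<Omega>" "u * h = 0"
  shows "h = 0"
  using assms
  by (induction arbitrary: h rule: denoms.induct)
     (auto simp: mult.assoc dest: one_plus_Var_sq_nonzerodivisor)

lemma frac_eq_iff_rel:
  assumes "s \<in> denoms UNIV" "t \<in> denoms UNIV"
  shows "frac f s = frac g t \<longleftrightarrow> loc_rel (f, s) (g, t)"
  unfolding frac_def
  using Quotient3_rel[OF Quotient3_mfrac, of "(f, s)" "(g, t)"] assms
  by (auto simp: loc_rel_refl_iff)

lemma frac_eq_iff_local: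
  assumes "s \<in> denoms \<Omega>" "t \<in> denoms \<Omega>"
  shows "frac f s = frac g t \<longleftrightarrow> (\<exists>u \<in> denoms \<Omega>. u * (f * t - g * s) = 0)"
proof -
  have st: "s \<in> denoms UNIV" "t \<in> denoms UNIV"
    using assms denoms_mono[of \<Omega> UNIV] by auto
  have "(\<exists>u \<in> denoms \<Omega>'. u * (f * t - g * s) = 0) \<longleftrightarrow> f * t - g * s = 0" for \<Omega>'
    by (metis denoms_nonzerodivisor denoms.one mult_zero_right)
  then show ?thesis
    using st by (simp add: frac_eq_iff_rel[OF st] loc_rel_def)
qed

lift_definition B_eval :: "('i \<Rightarrow> real) \<Rightarrow> 'i mfrac \<Rightarrow> real"
  is "\<lambda>\<alpha> (f, s). A_eval \<alpha> f / A_eval \<alpha> s"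
proof (clarify)
  fix \<alpha> :: "'i \<Rightarrow> real" and f s g t :: "'i mpoly"
  assume "loc_rel (f, s) (g, t)"
  then obtain u where u: "s \<in> denoms UNIV" "t \<in> denoms UNIV" "u \<in> denoms UNIV"
      "u * (f * t - g * s) = 0"
    by (auto simp: loc_rel_def)
  then have "f * t = g * s" using denoms_nonzerodivisor by fastforce
  then have "A_eval \<alpha> f * A_eval \<alpha> t = A_eval \<alpha> g * A_eval \<alpha> s"
    by (metis A_eval_mult)
  then show "A_eval \<alpha> f / A_eval \<alpha> s = A_eval \<alpha> g / A_eval \<alpha> t"
    using A_eval_denoms_pos[OF u(1), of \<alpha>] A_eval_denoms_pos[OF u(2), of \<alpha>]
    by (simp add: frac_eq_eq)
qed

lemma B_eval_frac:
  assumes "s \<in> denoms UNIV"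
  shows "B_eval \<alpha> (frac f s) = A_eval \<alpha> f / A_eval \<alpha> s"
  unfolding frac_def using assms by (simp add: B_eval.abs_eq loc_rel_refl_iff)


section \<open>Linear functionals\<close>

definition linear_functional_on :: "'a::real_vector set \<Rightarrow> ('a \<Rightarrow> real) \<Rightarrow> bool" where
  "linear_functional_on D L \<longleftrightarrow>
     (\<forall>x\<in>D. \<forall>y\<in>D. L (x + y) = L x + L y) \<and> (\<forall>c. \<forall>x\<in>D. L (c *\<^sub>R x) = c * L x)"

definition sum_squares :: "'a::comm_ring_1 set \<Rightarrow> 'a set" where
  "sum_squares D = {\<Sum>k<n. g k ^ 2 | (n::nat) g. \<forall>k<n. g k \<in> D}"

definition psd_on :: "'a::comm_ring_1 set \<Rightarrow> ('a \<Rightarrow> real) \<Rightarrow> bool" where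
  "psd_on D L \<longleftrightarrow> (\<forall>f \<in> sum_squares D. 0 \<le> L f)"

definition positive_on_A :: "'i set \<Rightarrow> ('i mpoly \<Rightarrow> real) \<Rightarrow> bool" where
  "positive_on_A \<Omega> L \<longleftrightarrow>
     (\<forall>f \<in> A_alg \<Omega>. (\<forall>\<alpha> \<in> \<Omega> \<rightarrow>\<^sub>E UNIV. 0 \<le> A_eval \<alpha> f) \<longrightarrow> 0 \<le> L f)"

definition positive_on_B :: "'i set \<Rightarrow> ('i mfrac \<Rightarrow> real) \<Rightarrow> bool" where
  "positive_on_B \<Omega> L \<longleftrightarrow>
     (\<forall>f \<in> B_alg \<Omega>. (\<forall>\<alpha> \<in> \<Omega> \<rightarrow>\<^sub>E UNIV. 0 \<le> B_eval \<alpha> f) \<longrightarrow> 0 \<le> L f)"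

definition extends_to_B :: "'i set \<Rightarrow> ('i mpoly \<Rightarrow> real) \<Rightarrow> ('i mfrac \<Rightarrow> real) \<Rightarrow> bool" where
  "extends_to_B \<Omega> L L' \<longleftrightarrow>
     linear_functional_on (B_alg \<Omega>) L' \<and> (\<forall>f \<in> A_alg \<Omega>. L' (A_to_B f) = L f)"

end

theory Submission
  imports Defs
begin

text \<open>Everything reduces to the following: if \<open>f\<close> is a nonnegative polynomial, then there is a
  polynomial \<open>q\<close> in the variables of \<open>f\<close> such that \<open>f + \<epsilon> q\<close> is a sum of squares in \<open>B\<close> for all
  \<open>\<epsilon> > 0\<close>.  The substitution \<open>x = tan (\<theta>/2)\<close> makes \<open>f / \<Prod>(1 + x\<^sub>i\<^sup>2)\<^sup>N\<close> the restriction \<open>F\<close> of a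
  polynomial to a torus, where \<open>F \<ge> 0\<close>.  Lipschitz continuity of \<open>F\<close> has an algebraic form: modulo
  sums of squares, \<open>F(p) \<ge> F(z) - \<epsilon> - C |p - z|\<^sup>2\<close> with \<open>C\<close> independent of \<open>z\<close>.  The variance of
  the Bernstein operators allows one to average the term \<open>C |p - z|\<^sup>2\<close> away, with weights that are
  sums of squares, so \<open>F + \<epsilon>\<close> is a sum of squares and \<open>q = \<Prod>(1 + x\<^sub>i\<^sup>2)\<^sup>N\<close> works.

  Letting \<open>\<epsilon> \<rightarrow> 0\<close>, this shows that PSD functionals on \<open>B\<close> are positive, and, after clearing
  denominators, that the third condition implies positivity; for small \<open>\<epsilon>\<close> the polynomials \<open>f\<close> and
  \<open>f + \<epsilon> q\<close> have the same variables.  A positive functional on \<open>A\<close> extends to \<open>B\<close> by the theorem of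
  M. Riesz, because \<open>g/s \<le> g\<^sup>2 + 1\<close> for every fraction.\<close>

section \<open>Cones of sums of squares\<close>

lemma zero_in_sum_squares [simp]: "0 \<in> sum_squares D"
  unfolding sum_squares_def by (rule CollectI, rule exI[of _ 0]) auto

lemma sum_squares_add_square:
  assumes "x \<in> sum_squares D" "y \<in> D"
  shows "x + y ^ 2 \<in> sum_squares D"
proof -
  obtain n :: nat and g where g: "x = (\<Sum>k<n. g k ^ 2)" "\<forall>k<n. g k \<in> D"
    using assms(1) unfolding sum_squares_def by blast
  have "x + y ^ 2 = (\<Sum>k<Suc n. (g(n := y)) k ^ 2)"
    by (simp add: g)
  moreover have "\<forall>k<Suc n. (g(n := y)) k \<in> D"
    using g assms by (auto simp: less_Suc_eq)
  ultimately show ?thesis unfolding sum_squares_def by blast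
qed

lemma square_in_sum_squares: "y \<in> D \<Longrightarrow> y ^ 2 \<in> sum_squares D"
  using sum_squares_add_square[of 0 D y] by simp

lemma sum_squares_induct [consumes 1, case_names zero add_square]:
  assumes "x \<in> sum_squares D" "P 0"
    and step: "\<And>x y. x \<in> sum_squares D \<Longrightarrow> P x \<Longrightarrow> y \<in> D \<Longrightarrow> P (x + y ^ 2)"
  shows "P x"
proof -
  obtain n :: nat and g where g: "x = (\<Sum>k<n. g k ^ 2)" "\<forall>k<n. g k \<in> D"
    using assms(1) unfolding sum_squares_def by blast
  have "(\<Sum>k<m. g k ^ 2) \<in> sum_squares D \<and> P (\<Sum>k<m. g k ^ 2)" if "m \<le> n" for m
    using that
    by (induction m) (use assms(2) g(2) in \<open>auto intro!: step sum_squares_add_square\<close>)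
  then show ?thesis using g by blast
qed

lemma sum_squares_add:
  assumes "x \<in> sum_squares D" "y \<in> sum_squares D"
  shows "x + y \<in> sum_squares D"
  using assms(2)
  by (induction rule: sum_squares_induct)
     (use assms(1) in \<open>auto simp: add.assoc[symmetric] intro: sum_squares_add_square\<close>)

text \<open>A product of squares is a square, so each \<open>a^2 * b^2\<close> stays in the cone;
  one induction runs over the squares of each factor.\<close>

lemma sum_squares_mult:
  assumes "x \<in> sum_squares D" "y \<in> sum_squares D"
    and D: "\<And>a b. a \<in> D \<Longrightarrow> b \<in> D \<Longrightarrow> a * b \<in> D"
  shows "x * y \<in> sum_squares D"
  using assms(2)
proof (induction rule: sum_squares_induct)
  case (add_square y b)
  have "x * b ^ 2 \<in> sum_squares D"
    using assms(1)
    by (induction rule: sum_squares_induct)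
       (use D add_square in \<open>auto simp: distrib_right power_mult_distrib[symmetric]
         intro: sum_squares_add_square\<close>)
  then show ?case using add_square by (simp add: distrib_left sum_squares_add)
qed simp

lemma sum_squares_mono: "D \<subseteq> D' \<Longrightarrow> sum_squares D \<subseteq> sum_squares D'"
  unfolding sum_squares_def by blast

section \<open>Real subalgebras: averaging over intervals and circles\<close>

locale real_subalgebra =
  fixes D :: "'a::{comm_ring_1, real_algebra_1} set"
  assumes of_real_mem [simp, intro]: "of_real c \<in> D"
    and add_mem [intro]: "x \<in> D \<Longrightarrow> y \<in> D \<Longrightarrow> x + y \<in> D"
    and mult_mem [intro]: "x \<in> D \<Longrightarrow> y \<in> D \<Longrightarrow> x * y \<in> D"
begin

abbreviation cone :: "'a set" where
  "cone \<equiv> sum_squares D"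

lemma one_mem [simp, intro]: "1 \<in> D"
  using of_real_mem[of 1] by simp

lemma minus_mem [intro]: "x \<in> D \<Longrightarrow> - x \<in> D"
  using mult_mem[OF of_real_mem[of "-1"]] by fastforce

lemma diff_mem [intro]: "x \<in> D \<Longrightarrow> y \<in> D \<Longrightarrow> x - y \<in> D"
  using add_mem[OF _ minus_mem] by fastforce

lemmas cone_add = sum_squares_add[where D = D]

lemma cone_mult: "x \<in> cone \<Longrightarrow> y \<in> cone \<Longrightarrow> x * y \<in> cone"
  by (rule sum_squares_mult) auto

lemma of_real_cone: "0 \<le> c \<Longrightarrow> of_real c \<in> cone"
  using square_in_sum_squares[of "of_real (sqrt c)" D]
  by (simp flip: of_real_power)

text \<open>The weights \<open>(1 + u)/2\<close> and \<open>(1 - u)/2\<close> lie in the cone and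
  sum to 1. A step \<open>+1\<close> or \<open>-1\<close> taken with these weights has mean
  \<open>u\<close> and variance \<open>1 - u^2\<close>, so averaging the two hypotheses lowers
  \<open>N\<close> by one and adds one copy of the variance to \<open>J\<close>.\<close>

lemma interval_step:
  fixes u :: 'a
  assumes "1 + u \<in> cone" "1 - u \<in> cone"
    and "f + c * ((N * u - (k + 1))\<^sup>2 + J * (1 - u\<^sup>2)) \<in> cone"
    and "f + c * ((N * u - (k - 1))\<^sup>2 + J * (1 - u\<^sup>2)) \<in> cone"
  shows "f + c * (((N - 1) * u - k)\<^sup>2 + (J + 1) * (1 - u\<^sup>2)) \<in> cone"
proof -
  let ?h = "of_real (1/2) :: 'a"
  let ?X = "f + c * ((N * u - (k + 1))\<^sup>2 + J * (1 - u\<^sup>2))"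
  let ?Y = "f + c * ((N * u - (k - 1))\<^sup>2 + J * (1 - u\<^sup>2))"
  let ?Z = "f + c * (((N - 1) * u - k)\<^sup>2 + (J + 1) * (1 - u\<^sup>2))"
  have h: "?h + ?h = 1" by (metis of_real_add of_real_1 field_sum_of_halves)
  have "?h * ((1 + u) * ?X + (1 - u) * ?Y) \<in> cone"
    by (intro cone_mult[OF of_real_cone] cone_add cone_mult[OF assms(1,3)] cone_mult[OF assms(2,4)])
       simp
  also have "(1 + u) * ?X + (1 - u) * ?Y = ?Z + ?Z"
    by (simp add: algebra_simps power2_eq_square)
  also have "?h * (?Z + ?Z) = (?h + ?h) * ?Z"
    by (simp add: algebra_simps)
  finally show ?thesis by (simp add: h)
qed

text \<open>The average of \<open>(u - a)\<^sup>2\<close> over the endpoint \<open>a\<close> of the walk with \<open>n\<close> steps \<open>\<plusminus> 1/n\<close> taken with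
  probabilities \<open>(1 \<plusminus> u)/2\<close> is \<open>(1 - u\<^sup>2)/n\<close>; the induction averages over one step at a time.\<close>

lemma interval_average:
  assumes "u \<in> D" "1 + u \<in> cone" "1 - u \<in> cone" "0 \<le> C" "0 < \<epsilon>"
    and hyp: "\<And>a. \<bar>a\<bar> \<le> 1 \<Longrightarrow> f + of_real C * (u - of_real a)\<^sup>2 \<in> cone"
  shows "f + of_real \<epsilon> \<in> cone"
proof -
  \<comment> \<open>The averaged error is \<open>C/n * (1 - u^2)\<close>, which has to stay below
    \<open>\<epsilon>\<close>.\<close>
  obtain n :: nat where n: "C / \<epsilon> < real n" "0 < n"
    by (metis reals_Archimedean2 gr0I of_nat_0 \<open>0 \<le> C\<close> \<open>0 < \<epsilon>\<close> divide_nonneg_pos not_less)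
  define c where "c = (of_real (C / (real n)\<^sup>2) :: 'a)"
  \<comment> \<open>Scaled by \<open>n\<close>, the walk has steps of size 1; \<open>k\<close> is
    its position after \<open>n - j\<close> steps, and the last \<open>j\<close> steps have been
    averaged out.\<close>
  have claim: "f + c * ((of_real (real n - real j) * u - of_real k)\<^sup>2
      + of_real (real j) * (1 - u\<^sup>2)) \<in> cone" if "j \<le> n" "\<bar>k\<bar> \<le> real n - real j" for j k
    using that
  proof (induction j arbitrary: k)
    case 0
    have "c * (of_real (real n) * u - of_real k)\<^sup>2
        = of_real (C / (real n)\<^sup>2 * (real n)\<^sup>2) * (u - of_real (k / real n))\<^sup>2"
    proof -
      have "of_real (real n) * of_real (k / real n) = (of_real (real n * (k / real n)) :: 'a)"
        by (simp only: of_real_mult)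
      then have "of_real (real n) * u - of_real k = of_real (real n) * (u - of_real (k / real n))"
        using n by (simp add: right_diff_distrib)
      then show ?thesis
        by (simp only: c_def power_mult_distrib of_real_mult of_real_power mult.assoc)
    qed
    with hyp[of "k / real n"] 0 n show ?case by simp
  next
    case (Suc j)
    have 1: "\<bar>k + 1\<bar> \<le> real n - real j" "\<bar>k - 1\<bar> \<le> real n - real j"
      using Suc.prems by auto
    have e: "of_real (real n - real (Suc j)) = (of_real (real n - real j) - 1 :: 'a)"
      by simp
    show ?case
      using interval_step[OF assms(2,3), of f c "of_real (real n - real j)" "of_real k"
          "of_real (real j)"] Suc.IH[OF _ 1(1)] Suc.IH[OF _ 1(2)] Suc.prems
      by (simp add: e diff_diff_eq add.commute)
  qed
  have "c * of_real (real n) = of_real (C / (real n)\<^sup>2 * real n)"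
    by (simp only: c_def of_real_mult)
  also have "C / (real n)\<^sup>2 * real n = C / real n"
    by (simp add: power2_eq_square)
  finally have "c * (of_real (real n) * (1 - u\<^sup>2)) = of_real (C / real n) * (1 - u\<^sup>2)"
    by (simp only: mult.assoc[symmetric])
  then have "f + of_real (C / real n) * (1 - u\<^sup>2) \<in> cone"
    using claim[of n 0] by simp
  \<comment> \<open>Adding this square turns \<open>C/n * (1 - u^2)\<close> into the constant
    \<open>C/n\<close>; what is missing up to \<open>\<epsilon>\<close> is a nonnegative
    scalar.\<close>
  moreover have "of_real (C / real n) * u\<^sup>2 \<in> cone"
    using assms by (intro cone_mult of_real_cone square_in_sum_squares) auto
  ultimately have "(f + of_real (C / real n) * (1 - u\<^sup>2)) + of_real (C / real n) * u\<^sup>2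
      + of_real (\<epsilon> - C / real n) \<in> cone"
    using n \<open>0 < \<epsilon>\<close> by (intro cone_add[OF cone_add] of_real_cone) (auto simp: field_simps)
  then show ?thesis by (simp add: algebra_simps)
qed

lemma cone_sum: "(\<And>i. i \<in> I \<Longrightarrow> f i \<in> cone) \<Longrightarrow> sum f I \<in> cone"
  by (induction I rule: infinite_finite_induct) (auto intro: cone_add)

text \<open>For unit vectors \<open>n = (c, d)\<close> and \<open>p = (u, v)\<close>,
  \<open>1 + <n,p>\<close> is half of \<open>|p + n|^2\<close>.\<close>

lemma unit_circle_functional:
  assumes "u \<in> D" "v \<in> D" "u\<^sup>2 + v\<^sup>2 = 1" "c\<^sup>2 + d\<^sup>2 = 1"
  shows "1 + (of_real c * u + of_real d * v) \<in> cone"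
proof -
  let ?c = "of_real c :: 'a" and ?d = "of_real d :: 'a" and ?h = "of_real (1/2) :: 'a"
  have 1: "?c\<^sup>2 + ?d\<^sup>2 = 1" by (metis assms(4) of_real_1 of_real_add of_real_power)
  have h: "?h + ?h = 1" by (metis of_real_add of_real_1 field_sum_of_halves)
  have "?h * ((u + ?c)\<^sup>2 + (v + ?d)\<^sup>2) \<in> cone"
    using assms by (intro cone_mult of_real_cone cone_add square_in_sum_squares) auto
  also have "(u + ?c)\<^sup>2 + (v + ?d)\<^sup>2
      = (u\<^sup>2 + v\<^sup>2) + (?c\<^sup>2 + ?d\<^sup>2) + ((?c * u + ?d * v) + (?c * u + ?d * v))"
    by (simp add: power2_eq_square algebra_simps)
  also have "?h * \<dots> = (?h + ?h) * (1 + (?c * u + ?d * v))"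
    by (simp only: assms(3) 1) (simp add: algebra_simps)
  finally show ?thesis by (simp add: h)
qed

text \<open>An affine function of \<open><n,p>\<close> that is nonnegative on \<open>[-1,1]\<close>
  is the constant \<open>\<alpha> - |\<beta>|\<close> plus a multiple of \<open>1 + <n,p>\<close> or
  \<open>1 - <n,p>\<close>; \<open>?\<sigma>\<close> moves the sign of \<open>\<beta>\<close> into
  \<open>n\<close>.\<close>

lemma unit_circle_affine:
  assumes "u \<in> D" "v \<in> D" "u\<^sup>2 + v\<^sup>2 = 1" "c\<^sup>2 + d\<^sup>2 = 1" "\<bar>\<beta>\<bar> \<le> \<alpha>"
  shows "of_real \<alpha> + of_real \<beta> * (of_real c * u + of_real d * v) \<in> cone"
proof -
  let ?\<sigma> = "if 0 \<le> \<beta> then 1 else -1 :: real"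
  have "of_real (\<alpha> - \<bar>\<beta>\<bar>)
      + of_real \<bar>\<beta>\<bar> * (1 + (of_real (?\<sigma> * c) * u + of_real (?\<sigma> * d) * v)) \<in> cone"
    using assms by (intro cone_add cone_mult unit_circle_functional of_real_cone) auto
  also have "of_real (\<alpha> - \<bar>\<beta>\<bar>) + of_real \<bar>\<beta>\<bar> * (1 + (of_real (?\<sigma> * c) * u + of_real (?\<sigma> * d) * v))
      = of_real \<alpha> + of_real \<beta> * (of_real c * u + of_real d * v)"
    by (auto simp: algebra_simps abs_if)
  finally show ?thesis .
qed

text \<open>Averaging over two intervals needs the hypothesis at all points of a square, but it is
  given on the circle only. At the price of a factor 4 it extends to the whole plane; then
  \<open>v\<close> and \<open>u\<close> are averaged in turn, each with half of
  \<open>\<epsilon>\<close>.\<close>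

lemma circle_average:
  assumes "u \<in> D" "v \<in> D" "u\<^sup>2 + v\<^sup>2 = 1" "0 \<le> C" "0 < \<epsilon>"
    and hyp: "\<And>a b. a\<^sup>2 + b\<^sup>2 = 1 \<Longrightarrow>
      f + of_real C * ((u - of_real a)\<^sup>2 + (v - of_real b)\<^sup>2) \<in> cone"
  shows "f + of_real \<epsilon> \<in> cone"
proof -
  text \<open>For a point \<open>r n\<close> of the plane with \<open>|n| = 1\<close> and a point \<open>p\<close> of the circle,
    \<open>4 |p - r n|\<^sup>2 - |p - n|\<^sup>2\<close> is an affine function of \<open>\<langle>n, p\<rangle>\<close>.\<close>
  have square: "f + of_real (4 * C) * ((u - of_real a)\<^sup>2 + (v - of_real b)\<^sup>2) \<in> cone" for a b
  proof -
    obtain r c d :: real where r: "0 \<le> r" "c\<^sup>2 + d\<^sup>2 = 1" "a = r * c" "b = r * d"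
    proof (cases "a = 0 \<and> b = 0")
      case True
      then show ?thesis using that[of 0 1 0] by simp
    next
      case False
      define r where "r = sqrt (a\<^sup>2 + b\<^sup>2)"
      have "r > 0" using False by (auto simp: r_def sum_power2_gt_zero_iff)
      moreover have "r\<^sup>2 = a\<^sup>2 + b\<^sup>2" by (simp add: r_def)
      ultimately have "(a / r)\<^sup>2 + (b / r)\<^sup>2 = 1"
        unfolding power_divide add_divide_distrib[symmetric] using False by simp
      with \<open>r > 0\<close> show ?thesis
        using that[of r "a / r" "b / r"]
        by simp
    qed
    let ?c = "of_real c :: 'a" and ?d = "of_real d :: 'a" and ?r = "of_real r :: 'a"
    have 1: "?c\<^sup>2 + ?d\<^sup>2 = 1" by (metis r(2) of_real_1 of_real_add of_real_power)
    \<comment> \<open>The affine function is \<open>2 + 4 * r^2 - (8 * r - 2) * <n,p>\<close>; it is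
      nonnegative on \<open>[-1,1]\<close> because \<open>4 * (r - 1)^2 >= 0\<close> and
      \<open>r >= 0\<close>.\<close>
    have "\<bar>- (8 * r - 2)\<bar> \<le> 2 + 4 * r\<^sup>2"
      using r(1) zero_le_power2[of "r - 1"] by (auto simp: abs_le_iff power2_eq_square algebra_simps)
    then have "(f + of_real C * ((u - ?c)\<^sup>2 + (v - ?d)\<^sup>2))
        + of_real C * (of_real (2 + 4 * r\<^sup>2) + of_real (- (8 * r - 2)) * (?c * u + ?d * v)) \<in> cone"
      using assms r by (intro cone_add[OF hyp] cone_mult unit_circle_affine of_real_cone) auto
    also have "of_real (2 + 4 * r\<^sup>2) + of_real (- (8 * r - 2)) * (?c * u + ?d * v)
        = 3 * (u\<^sup>2 + v\<^sup>2) + (4 * ?r\<^sup>2 - 1) * (?c\<^sup>2 + ?d\<^sup>2) - (8 * ?r - 2) * (?c * u + ?d * v)"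
      by (simp only: assms(3) 1) (simp add: algebra_simps)
    also have "(f + of_real C * ((u - ?c)\<^sup>2 + (v - ?d)\<^sup>2)) + of_real C * \<dots>
        = f + of_real (4 * C) * ((u - of_real a)\<^sup>2 + (v - of_real b)\<^sup>2)"
      unfolding r(3,4) of_real_mult by (simp add: power2_eq_square algebra_simps)
    finally show ?thesis .
  qed
  have pm: "1 + u \<in> cone" "1 - u \<in> cone" "1 + v \<in> cone" "1 - v \<in> cone"
    using unit_circle_functional[OF assms(1-3), of 1 0]
      unit_circle_functional[OF assms(1-3), of "-1" 0]
      unit_circle_functional[OF assms(1-3), of 0 1]
      unit_circle_functional[OF assms(1-3), of 0 "-1"] by simp_all
  have "f + of_real (4 * C) * (u - of_real a)\<^sup>2 + of_real (\<epsilon> / 2) \<in> cone" for a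
    by (rule interval_average[OF \<open>v \<in> D\<close> pm(3,4), of "4 * C"])
       (use square[of a] assms in \<open>auto simp: distrib_left add.assoc\<close>)
  then have "f + of_real (\<epsilon> / 2) + of_real (4 * C) * (u - of_real a)\<^sup>2 \<in> cone" for a
    by (simp add: add_ac)
  then have "f + of_real (\<epsilon> / 2) + of_real (\<epsilon> / 2) \<in> cone"
    by (intro interval_average[OF \<open>u \<in> D\<close> pm(1,2), of "4 * C"]) (use assms in auto)
  then show ?thesis
    unfolding add.assoc of_real_add[symmetric] by simp
qed

end

section \<open>Functions on a torus\<close>

text \<open>The pair \<open>(u, v)\<close> is a generic point of a product of circles: ring elements
  subject to the circle equations. The real points of the torus are the pairs \<open>(a, b)\<close>
  below.\<close>

locale torus_coordinates = real_subalgebra D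
  for D :: "'a::{comm_ring_1, real_algebra_1} set" +
  fixes I :: "'i set" and u v :: "'i \<Rightarrow> 'a"
  assumes finite_index [simp]: "finite I"
    and coordinates_mem: "i \<in> I \<Longrightarrow> u i \<in> D" "i \<in> I \<Longrightarrow> v i \<in> D"
    and circle_eq: "i \<in> I \<Longrightarrow> (u i)\<^sup>2 + (v i)\<^sup>2 = 1"
begin

definition dist2 :: "'i set \<Rightarrow> ('i \<Rightarrow> real) \<Rightarrow> ('i \<Rightarrow> real) \<Rightarrow> 'a" where
  "dist2 J a b = (\<Sum>i\<in>J. (u i - of_real (a i))\<^sup>2 + (v i - of_real (b i))\<^sup>2)"

definition torus :: "'i set \<Rightarrow> (('i \<Rightarrow> real) \<times> ('i \<Rightarrow> real)) set" where
  "torus J = {(a, b). \<forall>i\<in>J. (a i)\<^sup>2 + (b i)\<^sup>2 = 1}"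

text \<open>Induction over the circles: \<open>circle_average\<close> removes the new coordinate at
  the cost of half the error, and the induction hypothesis, applied to \<open>f\<close> plus the
  term of that coordinate, spends the other half.\<close>

lemma torus_average:
  assumes "J \<subseteq> I" "0 \<le> C" "0 < \<epsilon>"
    and "\<And>a b. (a, b) \<in> torus J \<Longrightarrow> f + of_real C * dist2 J a b \<in> cone"
  shows "f + of_real \<epsilon> \<in> cone"
proof -
  have "finite J" using assms(1) finite_index finite_subset by blast
  then show ?thesis using assms
  proof (induction J arbitrary: f \<epsilon>)
    case empty
    have "f \<in> cone" using empty(4) by (simp add: torus_def dist2_def)
    then show ?case using empty by (intro cone_add of_real_cone) auto
  next
    case (insert j J)
    have j: "j \<in> I" using insert by auto
    have "f + of_real (\<epsilon> / 2) + of_real (\<epsilon> / 2) \<in> cone"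
    proof (rule circle_average[OF coordinates_mem[OF j] circle_eq[OF j], of C])
      fix \<alpha> \<beta> :: real
      let ?t = "of_real C * ((u j - of_real \<alpha>)\<^sup>2 + (v j - of_real \<beta>)\<^sup>2)"
      assume ab: "\<alpha>\<^sup>2 + \<beta>\<^sup>2 = 1"
      have "f + ?t + of_real (\<epsilon> / 2) \<in> cone"
      proof (rule insert.IH)
        fix a b assume "(a, b) \<in> torus J"
        then have "(a(j := \<alpha>), b(j := \<beta>)) \<in> torus (insert j J)"
          using ab by (auto simp: torus_def)
        note insert.prems(4)[OF this]
        also have "dist2 (insert j J) (a(j := \<alpha>)) (b(j := \<beta>))
            = ((u j - of_real \<alpha>)\<^sup>2 + (v j - of_real \<beta>)\<^sup>2) + dist2 J a b"
          using insert.hyps unfolding dist2_def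
          by (auto intro!: sum.cong)
        finally show "f + ?t + of_real C * dist2 J a b \<in> cone"
          by (simp add: distrib_left add.assoc)
      qed (use insert in auto)
      then show "f + of_real (\<epsilon> / 2) + ?t \<in> cone" by (simp add: add_ac)
    qed (use insert in auto)
    then show ?case unfolding add.assoc of_real_add[symmetric] by simp
  qed
qed

text \<open>An element \<open>x\<close> stands for the function \<open>g\<close>: its difference to the value \<open>g z\<close> satisfies a
  Lipschitz estimate in which \<open>\<ge> 0\<close> is replaced by membership in the cone.\<close>

definition represents :: "'a \<Rightarrow> (('i \<Rightarrow> real) \<Rightarrow> ('i \<Rightarrow> real) \<Rightarrow> real) \<Rightarrow> bool" where
  "represents x g \<longleftrightarrow> x \<in> D \<and>
     (\<exists>C\<ge>0. \<forall>(a, b)\<in>torus I. of_real C * dist2 I a b - (x - of_real (g a b))\<^sup>2 \<in> cone) \<and>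
     (\<exists>M\<ge>0. of_real M - x\<^sup>2 \<in> cone \<and> (\<forall>(a, b)\<in>torus I. (g a b)\<^sup>2 \<le> M))"

lemma representsE:
  assumes "represents x g"
  obtains C M where "x \<in> D" "0 \<le> C" "0 \<le> M"
    "\<And>a b. (a, b) \<in> torus I \<Longrightarrow> of_real C * dist2 I a b - (x - of_real (g a b))\<^sup>2 \<in> cone"
    "of_real M - x\<^sup>2 \<in> cone" "\<And>a b. (a, b) \<in> torus I \<Longrightarrow> (g a b)\<^sup>2 \<le> M"
  using assms unfolding represents_def by fast

lemma representsI:
  assumes "x \<in> D" "0 \<le> C" "0 \<le> M"
    "\<And>a b. (a, b) \<in> torus I \<Longrightarrow> of_real C * dist2 I a b - (x - of_real (g a b))\<^sup>2 \<in> cone"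
    "of_real M - x\<^sup>2 \<in> cone" "\<And>a b. (a, b) \<in> torus I \<Longrightarrow> (g a b)\<^sup>2 \<le> M"
  shows "represents x g"
  using assms unfolding represents_def by fast

lemma represents_const: "represents (of_real c) (\<lambda>_ _. c)"
  by (rule representsI[of _ 0 "c\<^sup>2"]) auto

text \<open>\<open>(u i - a i)^2\<close> is one summand of \<open>dist2\<close> and the others are
  squares, so the Lipschitz constant is 1; the bound is \<open>1 - u^2 = v^2\<close>. The same holds
  with \<open>u\<close> and \<open>v\<close> exchanged.\<close>

lemma represents_coordinates:
  assumes "i \<in> I"
  shows "represents (u i) (\<lambda>a b. a i)" "represents (v i) (\<lambda>a b. b i)"
proof -
  note mem = coordinates_mem[OF assms]
  have split: "dist2 I a b = (u i - of_real (a i))\<^sup>2 + (v i - of_real (b i))\<^sup>2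
      + (\<Sum>j\<in>I-{i}. (u j - of_real (a j))\<^sup>2 + (v j - of_real (b j))\<^sup>2)" for a b
    unfolding dist2_def using assms by (subst sum.remove) auto
  have rest: "(\<Sum>j\<in>I-{i}. (u j - of_real (a j))\<^sup>2 + (v j - of_real (b j))\<^sup>2) \<in> cone" for a b
    by (intro cone_sum cone_add square_in_sum_squares) (auto intro: coordinates_mem)
  have le: "(a i)\<^sup>2 \<le> 1 \<and> (b i)\<^sup>2 \<le> 1" if "(a, b) \<in> torus I" for a b
    using that assms unfolding torus_def
    by (metis (mono_tags, lifting) case_prodD le_add_same_cancel1 le_add_same_cancel2
        mem_Collect_eq zero_le_power2)
  show "represents (u i) (\<lambda>a b. a i)"
  proof (rule representsI[of _ 1 1])
    show "of_real 1 * dist2 I a b - (u i - of_real (a i))\<^sup>2 \<in> cone" for a b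
      using cone_add[OF square_in_sum_squares rest, of "v i - of_real (b i)"] mem
      by (auto simp: split)
    show "of_real 1 - (u i)\<^sup>2 \<in> cone"
      using square_in_sum_squares[OF mem(2)] by (simp flip: circle_eq[OF assms])
  qed (use mem le in auto)
  show "represents (v i) (\<lambda>a b. b i)"
  proof (rule representsI[of _ 1 1])
    show "of_real 1 * dist2 I a b - (v i - of_real (b i))\<^sup>2 \<in> cone" for a b
      using cone_add[OF square_in_sum_squares rest, of "u i - of_real (a i)"] mem
      by (auto simp: split)
    show "of_real 1 - (v i)\<^sup>2 \<in> cone"
      using square_in_sum_squares[OF mem(1)] by (simp flip: circle_eq[OF assms])
  qed (use mem le in auto)
qed

text \<open>Lipschitz estimate and bound both follow from
  \<open>2 * (s^2 + t^2) - (s + t)^2 = (s - t)^2\<close>, at the cost of a factor 2.\<close>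

lemma represents_add:
  assumes "represents x g" "represents y h"
  shows "represents (x + y) (\<lambda>a b. g a b + h a b)"
proof -
  obtain C M where x: "x \<in> D" "0 \<le> C" "0 \<le> M"
    "\<And>a b. (a, b) \<in> torus I \<Longrightarrow> of_real C * dist2 I a b - (x - of_real (g a b))\<^sup>2 \<in> cone"
    "of_real M - x\<^sup>2 \<in> cone" "\<And>a b. (a, b) \<in> torus I \<Longrightarrow> (g a b)\<^sup>2 \<le> M"
    using representsE[OF assms(1)] by metis
  obtain C' M' where y: "y \<in> D" "0 \<le> C'" "0 \<le> M'"
    "\<And>a b. (a, b) \<in> torus I \<Longrightarrow> of_real C' * dist2 I a b - (y - of_real (h a b))\<^sup>2 \<in> cone"
    "of_real M' - y\<^sup>2 \<in> cone" "\<And>a b. (a, b) \<in> torus I \<Longrightarrow> (h a b)\<^sup>2 \<le> M'"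
    using representsE[OF assms(2)] by metis
  have parallelogram: "of_real (2 * (c + c')) * t - (s + s')\<^sup>2 \<in> cone"
    if "of_real c * t - s\<^sup>2 \<in> cone" "of_real c' * t - s'\<^sup>2 \<in> cone" "s \<in> D" "s' \<in> D"
    for c c' and t s s' :: 'a
  proof -
    have "of_real 2 * ((of_real c * t - s\<^sup>2) + (of_real c' * t - s'\<^sup>2)) + (s - s')\<^sup>2 \<in> cone"
      using that by (intro cone_add[OF cone_mult] cone_add[OF that(1,2)] of_real_cone
          square_in_sum_squares) auto
    then show ?thesis by (simp add: power2_eq_square algebra_simps)
  qed
  show ?thesis
  proof (rule representsI[of _ "2 * (C + C')" "2 * (M + M')"])
    fix a b assume ab: "(a, b) \<in> torus I"
    show "of_real (2 * (C + C')) * dist2 I a b - (x + y - of_real (g a b + h a b))\<^sup>2 \<in> cone"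
      using parallelogram[OF x(4)[OF ab] y(4)[OF ab]] x y by (simp add: add_diff_add diff_mem)
    have "(g a b + h a b)\<^sup>2 \<le> 2 * ((g a b)\<^sup>2 + (h a b)\<^sup>2)"
      using zero_le_power2[of "g a b - h a b"] by (simp add: power2_eq_square algebra_simps)
    also have "\<dots> \<le> 2 * (M + M')"
      using add_mono[OF x(6)[OF ab] y(6)[OF ab]] by simp
    finally show "(g a b + h a b)\<^sup>2 \<le> 2 * (M + M')" .
  next
    show "of_real (2 * (M + M')) - (x + y)\<^sup>2 \<in> cone"
      using parallelogram[of M 1 x M' y] x y by simp
  qed (use x y in auto)
qed

text \<open>Product rule \<open>x y - g h = (x - g) y + g (y - h)\<close>: the differences are
  controlled by the Lipschitz constants, the cofactors by the bounds. This is why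
  \<open>represents\<close> records bounds too.\<close>

lemma represents_mult:
  assumes "represents x g" "represents y h"
  shows "represents (x * y) (\<lambda>a b. g a b * h a b)"
proof -
  obtain C M where x: "x \<in> D" "0 \<le> C" "0 \<le> M"
    "\<And>a b. (a, b) \<in> torus I \<Longrightarrow> of_real C * dist2 I a b - (x - of_real (g a b))\<^sup>2 \<in> cone"
    "of_real M - x\<^sup>2 \<in> cone" "\<And>a b. (a, b) \<in> torus I \<Longrightarrow> (g a b)\<^sup>2 \<le> M"
    using representsE[OF assms(1)] by metis
  obtain C' M' where y: "y \<in> D" "0 \<le> C'" "0 \<le> M'"
    "\<And>a b. (a, b) \<in> torus I \<Longrightarrow> of_real C' * dist2 I a b - (y - of_real (h a b))\<^sup>2 \<in> cone"
    "of_real M' - y\<^sup>2 \<in> cone" "\<And>a b. (a, b) \<in> torus I \<Longrightarrow> (h a b)\<^sup>2 \<le> M'"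
    using representsE[OF assms(2)] by metis
  show ?thesis
  proof (rule representsI[of _ "2 * (C * M' + M * C')" "M * M'"])
    fix a b assume ab: "(a, b) \<in> torus I"
    let ?g = "of_real (g a b) :: 'a" and ?h = "of_real (h a b) :: 'a" and ?d = "dist2 I a b"
    let ?s = "x - ?g" and ?t = "y - ?h"
    have gM: "of_real M - ?g\<^sup>2 \<in> cone"
      using of_real_cone[of "M - (g a b)\<^sup>2"] x(6)[OF ab] by simp
    \<comment> \<open>The last square turns twice the sum of two squares into the square of the sum,
      as for addition.\<close>
    have "of_real 2 * (((of_real C * ?d - ?s\<^sup>2) * of_real M' + ?s\<^sup>2 * (of_real M' - y\<^sup>2))
        + (of_real M * (of_real C' * ?d - ?t\<^sup>2) + (of_real M - ?g\<^sup>2) * ?t\<^sup>2))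
        + (?s * y - ?g * ?t)\<^sup>2 \<in> cone" (is "?e \<in> cone")
      by (intro cone_add cone_mult of_real_cone square_in_sum_squares x(4)[OF ab] y(4)[OF ab]
          x(5) y(5) gM diff_mem mult_mem x(1-3) y(1-3) of_real_mem) simp
    also have "?e = of_real (2 * (C * M' + M * C')) * ?d - (?s * y + ?g * ?t)\<^sup>2"
      by (simp add: power2_eq_square algebra_simps)
    also have "?s * y + ?g * ?t = x * y - of_real (g a b * h a b)"
      by (simp add: algebra_simps)
    finally show "of_real (2 * (C * M' + M * C')) * ?d - (x * y - of_real (g a b * h a b))\<^sup>2 \<in> cone" .
    show "(g a b * h a b)\<^sup>2 \<le> M * M'"
      using x(6)[OF ab] y(6)[OF ab] x(3) by (simp add: power_mult_distrib mult_mono)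
  next
    have "(of_real M - x\<^sup>2) * of_real M' + x\<^sup>2 * (of_real M' - y\<^sup>2) \<in> cone"
      using x y by (intro cone_add cone_mult of_real_cone square_in_sum_squares)
    then show "of_real (M * M') - (x * y)\<^sup>2 \<in> cone"
      by (simp add: algebra_simps power_mult_distrib)
  qed (use x y in auto)
qed

lemma represents_power: "represents x g \<Longrightarrow> represents (x ^ n) (\<lambda>a b. g a b ^ n)"
  by (induction n) (use represents_const[of 1] in \<open>auto intro: represents_mult\<close>)

lemma represents_prod:
  assumes "\<And>j. j \<in> J \<Longrightarrow> represents (x j) (g j)"
  shows "represents (\<Prod>j\<in>J. x j) (\<lambda>a b. \<Prod>j\<in>J. g j a b)"
  using assms
  by (induction J rule: infinite_finite_induct)
     (use represents_const[of 1] in \<open>auto intro: represents_mult\<close>)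

lemma represents_sum:
  assumes "\<And>j. j \<in> J \<Longrightarrow> represents (x j) (g j)"
  shows "represents (\<Sum>j\<in>J. x j) (\<lambda>a b. \<Sum>j\<in>J. g j a b)"
  using assms
  by (induction J rule: infinite_finite_induct)
     (use represents_const[of 0] in \<open>auto intro: represents_add\<close>)

text \<open>AM-GM, \<open>x - g \<ge> - \<epsilon>/2 - (x - g)\<^sup>2 / (2 \<epsilon>)\<close>, feeds the representation into
  \<open>torus_average\<close>.\<close>

theorem represents_nonneg:
  assumes "represents x g" "\<And>a b. (a, b) \<in> torus I \<Longrightarrow> 0 \<le> g a b" "0 < \<epsilon>"
  shows "x + of_real \<epsilon> \<in> cone"
proof -
  obtain C M where x: "x \<in> D" "0 \<le> C" "0 \<le> M"
    "\<And>a b. (a, b) \<in> torus I \<Longrightarrow> of_real C * dist2 I a b - (x - of_real (g a b))\<^sup>2 \<in> cone"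
    "of_real M - x\<^sup>2 \<in> cone" "\<And>a b. (a, b) \<in> torus I \<Longrightarrow> (g a b)\<^sup>2 \<le> M"
    using representsE[OF assms(1)] by metis
  define k where "k = 1 / (2 * \<epsilon>)"
  have k: "0 \<le> k" "k * (\<epsilon> * 2) = 1" "k * \<epsilon>\<^sup>2 = \<epsilon> / 2"
    using assms by (auto simp: k_def power2_eq_square)
  have "x + of_real (\<epsilon> / 2) + of_real (\<epsilon> / 2) \<in> cone"
  proof (rule torus_average[of I "k * C"])
    fix a b assume ab: "(a, b) \<in> torus I"
    let ?s = "x - of_real (g a b)"
    \<comment> \<open>Since \<open>2 * k * \<epsilon> = 1\<close>, the \<open>?s^2\<close> terms
      cancel and \<open>?s + \<epsilon>/2\<close> remains; with \<open>g\<close> this gives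
      \<open>x + \<epsilon>/2\<close>.\<close>
    have "of_real (g a b) + of_real k * (?s + of_real \<epsilon>)\<^sup>2
        + of_real k * (of_real C * dist2 I a b - ?s\<^sup>2) \<in> cone" (is "?e \<in> cone")
      using x k assms(2)[OF ab] ab
      by (intro cone_add[OF cone_add] cone_mult of_real_cone square_in_sum_squares x(4)) auto
    also have "?e = of_real (g a b) + of_real (k * (\<epsilon> * 2)) * ?s + of_real (k * \<epsilon>\<^sup>2)
        + of_real (k * C) * dist2 I a b"
      by (simp add: power2_eq_square algebra_simps)
    finally show "x + of_real (\<epsilon> / 2) + of_real (k * C) * dist2 I a b \<in> cone"
      unfolding k(2,3) by simp
  qed (use x k assms in auto)
  then show ?thesis unfolding add.assoc of_real_add[symmetric] by simp
qed

end

section \<open>The algebras \<open>A\<close> and \<open>B\<close>\<close>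

lemma vars_add: "vars (f + g) \<subseteq> vars f \<union> vars g"
  using keys_add[of f g] by (auto simp: vars_def)

lemma vars_mult: "vars (f * g) \<subseteq> vars f \<union> vars g"
proof
  fix i assume "i \<in> vars (f * g)"
  then obtain m where m: "m \<in> Poly_Mapping.keys (f * g)" "i \<in> Poly_Mapping.keys m"
    by (auto simp: vars_def)
  then obtain a b where ab: "m = a + b" "a \<in> Poly_Mapping.keys f" "b \<in> Poly_Mapping.keys g"
    using keys_mult[of f g] by blast
  then show "i \<in> vars f \<union> vars g"
    using m keys_add[of a b] by (auto simp: vars_def)
qed

lemma finite_vars [simp]: "finite (vars f)"
  by (simp add: vars_def)

lemma A_alg_mono: "V \<subseteq> W \<Longrightarrow> A_alg V \<subseteq> A_alg W"
  by (auto simp: A_alg_def)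

lemma A_alg_add: "f \<in> A_alg V \<Longrightarrow> g \<in> A_alg V \<Longrightarrow> f + g \<in> A_alg V"
  using vars_add[of f g] by (auto simp: A_alg_def)

lemma A_alg_mult: "f \<in> A_alg V \<Longrightarrow> g \<in> A_alg V \<Longrightarrow> f * g \<in> A_alg V"
  using vars_mult[of f g] by (auto simp: A_alg_def)

lemma A_alg_const: "Poly_Mapping.single 0 c \<in> A_alg V"
  by (simp add: A_alg_def vars_def)

lemma A_alg_one: "1 \<in> A_alg V"
  using A_alg_const[of 1 V] by simp

lemma A_alg_Var: "i \<in> V \<Longrightarrow> Var i \<in> A_alg V"
  by (simp add: A_alg_def vars_def Var_def)

lemma A_alg_scaleR: "f \<in> A_alg V \<Longrightarrow> c *\<^sub>R f \<in> A_alg V"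
  by (simp add: scaleR_poly_mapping_eq A_alg_mult A_alg_const)

lemma A_alg_power: "f \<in> A_alg V \<Longrightarrow> f ^ n \<in> A_alg V"
  by (induction n) (auto intro: A_alg_one A_alg_mult)

lemma A_alg_one_plus_Var_sq: "i \<in> V \<Longrightarrow> 1 + Var i ^ 2 \<in> A_alg V"
  by (intro A_alg_add A_alg_one A_alg_power A_alg_Var)

lemma A_alg_sum_squares_mult:
  "f \<in> sum_squares (A_alg V) \<Longrightarrow> g \<in> sum_squares (A_alg V) \<Longrightarrow> f * g \<in> sum_squares (A_alg V)"
  by (rule sum_squares_mult) (auto intro: A_alg_mult)

lemma denoms_subset_A_alg: "s \<in> denoms V \<Longrightarrow> s \<in> A_alg V"
  by (induction rule: denoms.induct) (auto intro: A_alg_one A_alg_mult A_alg_one_plus_Var_sq)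

lemma denoms_sum_squares: "s \<in> denoms V \<Longrightarrow> s \<in> sum_squares (A_alg V)"
proof (induction rule: denoms.induct)
  case one
  show ?case using square_in_sum_squares[OF A_alg_one[of V]] by simp
next
  case (step s i)
  have "1 ^ 2 + Var i ^ 2 \<in> sum_squares (A_alg V)"
    using step by (intro sum_squares_add square_in_sum_squares A_alg_one A_alg_Var)
  then show ?case using step by (intro A_alg_sum_squares_mult) simp_all
qed

section \<open>Denominators and evaluation\<close>

lemma denoms_UNIV: "s \<in> denoms V \<Longrightarrow> s \<in> denoms UNIV"
  using denoms_mono[of V UNIV] by auto

lemma one_plus_Var_sq_denoms: "i \<in> V \<Longrightarrow> 1 + Var i ^ 2 \<in> denoms V"
  using denoms.step[OF denoms.one, of i V] by simp

lemma denoms_power: "s \<in> denoms V \<Longrightarrow> s ^ n \<in> denoms V"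
  by (induction n) (auto intro: denoms.one denoms_mult)

lemma denoms_prod: "(\<And>j. j \<in> J \<Longrightarrow> f j \<in> denoms V) \<Longrightarrow> prod f J \<in> denoms V"
  by (induction J rule: infinite_finite_induct) (auto intro: denoms.one denoms_mult)

text \<open>Collecting equal factors gives the explicit form of the multipliers in the third
  condition.\<close>

lemma denoms_eq_prod:
  assumes "finite V" "s \<in> denoms V"
  obtains l :: "'i \<Rightarrow> nat" where "s = (\<Prod>i\<in>V. (1 + Var i ^ 2) ^ l i)"
  using assms(2)
proof (induction arbitrary: thesis rule: denoms.induct)
  case one
  show ?case by (rule one[of "\<lambda>_. 0"]) simp
next
  case (step s i)
  then obtain l where l: "s = (\<Prod>j\<in>V. (1 + Var j ^ 2) ^ l j)" by blast
  have "(\<Prod>j\<in>V-{i}. (1 + Var j ^ 2) ^ (l(i := Suc (l i))) j) = (\<Prod>j\<in>V-{i}. (1 + Var j ^ 2) ^ l j)"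
    by (rule prod.cong) auto
  then have "(1 + Var i ^ 2) * s = (\<Prod>j\<in>V. (1 + Var j ^ 2) ^ (l(i := Suc (l i))) j)"
    using step.hyps assms(1) by (simp add: l prod.remove[of V i] mult.assoc del: fun_upd_apply) simp
  then show ?case by (rule step.prems)
qed

text \<open>Used to bound a fraction \<open>g/s\<close> pointwise by \<open>|g|\<close>.\<close>

lemma A_eval_denoms_ge_1: "s \<in> denoms V \<Longrightarrow> 1 \<le> A_eval \<alpha> s"
proof (induction rule: denoms.induct)
  case (step s i)
  have "1 * 1 \<le> (1 + (\<alpha> i)\<^sup>2) * A_eval \<alpha> s"
    using step by (intro mult_mono) auto
  then show ?case
    by (simp add: A_eval_mult A_eval_add power2_eq_square)
qed simp

lemma A_eval_cong:
  assumes "\<And>i. i \<in> vars f \<Longrightarrow> \<alpha> i = \<beta> i"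
  shows "A_eval \<alpha> f = A_eval \<beta> f"
  unfolding A_eval_def monom_eval_def
  by (intro sum.cong prod.cong arg_cong2[of _ _ _ _ "(*)"] arg_cong2[of _ _ _ _ "(^)"] refl assms)
     (auto simp: vars_def)

text \<open>Positivity is tested at extensional points over the index set; this transfers it to all
  assignments.\<close>

lemma A_eval_restrict:
  assumes "f \<in> A_alg V"
  shows "A_eval (restrict \<alpha> V) f = A_eval \<alpha> f"
  using assms by (intro A_eval_cong) (auto simp: A_alg_def)

lemma A_eval_power: "A_eval \<alpha> (f ^ n) = A_eval \<alpha> f ^ n"
  by (induction n) (auto simp: A_eval_mult)

text \<open>Denominators are not zero divisors, so the extra factor in the localization relation
  cancels.\<close>

lemma frac_eq_iff:
  assumes "s \<in> denoms V" "t \<in> denoms W"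
  shows "frac f s = frac g t \<longleftrightarrow> f * t = g * s"
  unfolding frac_eq_iff_local[OF denoms_UNIV[OF assms(1)] denoms_UNIV[OF assms(2)]]
  using denoms_nonzerodivisor denoms.one by fastforce

lemma frac_add:
  assumes "s \<in> denoms V" "t \<in> denoms W"
  shows "frac f s + frac g t = frac (f * t + g * s) (s * t)"
  unfolding frac_def using assms denoms_UNIV
  by (subst plus_mfrac.abs_eq) (auto simp: loc_rel_refl_iff)

lemma frac_mult:
  assumes "s \<in> denoms V" "t \<in> denoms W"
  shows "frac f s * frac g t = frac (f * g) (s * t)"
  unfolding frac_def using assms denoms_UNIV
  by (subst times_mfrac.abs_eq) (auto simp: loc_rel_refl_iff)

lemma frac_scaleR:
  assumes "s \<in> denoms V"
  shows "c *\<^sub>R frac f s = frac (c *\<^sub>R f) s"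
  unfolding frac_def using assms denoms_UNIV
  by (subst scaleR_mfrac.abs_eq) (auto simp: loc_rel_refl_iff)

section \<open>The embedding of \<open>A\<close> into \<open>B\<close>\<close>

lemma A_to_B_add: "A_to_B (f + g) = A_to_B f + A_to_B g"
  by (simp add: A_to_B_def frac_add[OF denoms.one denoms.one])

lemma A_to_B_mult: "A_to_B (f * g) = A_to_B f * A_to_B g"
  by (simp add: A_to_B_def frac_mult[OF denoms.one denoms.one])

lemma A_to_B_scaleR: "A_to_B (c *\<^sub>R f) = c *\<^sub>R A_to_B f"
  by (simp add: A_to_B_def frac_scaleR[OF denoms.one])

lemma A_to_B_one [simp]: "A_to_B 1 = 1"
  by (simp add: A_to_B_def frac_def one_mfrac_def)

lemma A_to_B_zero [simp]: "A_to_B 0 = 0"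
  by (simp add: A_to_B_def frac_def zero_mfrac_def)

lemma A_to_B_sum: "A_to_B (sum f J) = (\<Sum>j\<in>J. A_to_B (f j))"
  by (induction J rule: infinite_finite_induct) (auto simp: A_to_B_add)

lemma A_to_B_prod: "A_to_B (prod f J) = (\<Prod>j\<in>J. A_to_B (f j))"
  by (induction J rule: infinite_finite_induct) (auto simp: A_to_B_mult)

lemma A_to_B_power: "A_to_B (f ^ n) = A_to_B f ^ n"
  by (induction n) (auto simp: A_to_B_mult)

lemma A_to_B_const: "A_to_B (Poly_Mapping.single 0 c) = of_real c"
  using A_to_B_scaleR[of c 1] by (simp add: scaleR_poly_mapping_eq of_real_def)

lemma inj_A_to_B: "A_to_B f = A_to_B g \<Longrightarrow> f = g"
  by (simp add: A_to_B_def frac_eq_iff[OF denoms.one denoms.one])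

lemma frac_eq_mult: "s \<in> denoms V \<Longrightarrow> frac f s = A_to_B f * frac 1 s"
  by (simp add: A_to_B_def frac_mult[OF denoms.one])

lemma A_to_B_mult_inverse: "s \<in> denoms V \<Longrightarrow> A_to_B s * frac 1 s = 1"
  using frac_eq_iff[OF _ denoms.one, of s V s 1]
  by (simp add: frac_eq_mult[symmetric] flip: A_to_B_one) (simp add: A_to_B_def)

lemma frac_mem_B_alg: "f \<in> A_alg V \<Longrightarrow> s \<in> denoms V \<Longrightarrow> frac f s \<in> B_alg V"
  by (auto simp: B_alg_def)

lemma A_to_B_mem: "f \<in> A_alg V \<Longrightarrow> A_to_B f \<in> B_alg V"
  by (simp add: A_to_B_def frac_mem_B_alg denoms.one)

lemma B_algE:
  assumes "x \<in> B_alg V"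
  obtains f s where "f \<in> A_alg V" "s \<in> denoms V" "x = frac f s"
  using assms by (auto simp: B_alg_def)

lemma B_alg_add: "x \<in> B_alg V \<Longrightarrow> y \<in> B_alg V \<Longrightarrow> x + y \<in> B_alg V"
  by (elim B_algE)
     (auto simp: frac_add denoms_subset_A_alg
       intro!: frac_mem_B_alg A_alg_add A_alg_mult denoms_mult)

lemma B_alg_mult: "x \<in> B_alg V \<Longrightarrow> y \<in> B_alg V \<Longrightarrow> x * y \<in> B_alg V"
  by (elim B_algE) (auto simp: frac_mult intro!: frac_mem_B_alg A_alg_mult denoms_mult)

interpretation B_alg: real_subalgebra "B_alg V"
proof
  show "of_real c \<in> B_alg V" for c
    by (metis A_to_B_const A_to_B_mem A_alg_const)
qed (auto intro: B_alg_add B_alg_mult)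

lemma subspace_B_alg: "subspace (B_alg V)"
  using B_alg.of_real_mem[of _ V] B_alg.of_real_mem[of 0 V]
  by (auto simp: subspace_def B_alg_add scaleR_conv_of_real intro: B_alg_mult simp del: B_alg.of_real_mem)

lemma subspace_A_alg: "subspace (A_alg V)"
  using A_alg_const[of 0 V] by (auto simp: subspace_def A_alg_add A_alg_scaleR)

lemma B_alg_mono: "V \<subseteq> W \<Longrightarrow> B_alg V \<subseteq> B_alg W"
  using A_alg_mono[of V W] denoms_mono[of V W] unfolding B_alg_def by blast

lemma B_eval_A_to_B [simp]: "B_eval \<alpha> (A_to_B f) = A_eval \<alpha> f"
  by (simp add: A_to_B_def B_eval_frac denoms.one)

lemma B_eval_add:
  assumes "x \<in> B_alg V" "y \<in> B_alg V"
  shows "B_eval \<alpha> (x + y) = B_eval \<alpha> x + B_eval \<alpha> y"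
proof -
  obtain f s g t where *: "x = frac f s" "y = frac g t" "s \<in> denoms V" "t \<in> denoms V"
    using assms by (auto elim!: B_algE)
  then have "A_eval \<alpha> s > 0" "A_eval \<alpha> t > 0" by (auto intro: A_eval_denoms_pos)
  then show ?thesis
    using denoms_UNIV[OF *(3)] denoms_UNIV[OF *(4)]
    by (simp add: * frac_add[OF *(3,4)] B_eval_frac denoms_mult A_eval_add A_eval_mult
        add_divide_distrib)
qed

lemma B_eval_mult:
  assumes "x \<in> B_alg V" "y \<in> B_alg V"
  shows "B_eval \<alpha> (x * y) = B_eval \<alpha> x * B_eval \<alpha> y"
proof -
  obtain f s g t where *: "x = frac f s" "y = frac g t" "s \<in> denoms V" "t \<in> denoms V"
    using assms by (auto elim!: B_algE)
  then show ?thesis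
    using denoms_UNIV[OF *(3)] denoms_UNIV[OF *(4)]
    by (simp add: * frac_mult[OF *(3,4)] B_eval_frac denoms_mult A_eval_mult)
qed

lemma B_eval_scaleR:
  assumes "x \<in> B_alg V"
  shows "B_eval \<alpha> (c *\<^sub>R x) = c * B_eval \<alpha> x"
  using assms
  by (elim B_algE) (simp add: frac_scaleR B_eval_frac[OF denoms_UNIV] A_eval_scaleR)

section \<open>Sums of squares in \<open>B\<close> and clearing denominators\<close>

lemma B_eval_sum_squares_nonneg:
  assumes "x \<in> sum_squares (B_alg V)"
  shows "x \<in> B_alg V \<and> 0 \<le> B_eval \<alpha> x"
  using assms
proof (induction rule: sum_squares_induct)
  case zero
  show ?case using B_alg.of_real_mem[of 0 V] B_eval_A_to_B[of \<alpha> 0] by (simp del: B_alg.of_real_mem)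
next
  case (add_square x y)
  then show ?case
    by (simp add: power2_eq_square B_alg_add B_alg_mult B_eval_add[of _ V] B_eval_mult[of _ V])
qed

lemma A_eval_sum_squares_nonneg: "f \<in> sum_squares (A_alg V) \<Longrightarrow> 0 \<le> A_eval \<alpha> f"
  by (induction rule: sum_squares_induct) (auto simp: A_eval_add A_eval_power)

lemma A_to_B_sum_squares: "f \<in> sum_squares (A_alg V) \<Longrightarrow> A_to_B f \<in> sum_squares (B_alg V)"
  by (induction rule: sum_squares_induct)
     (auto simp: A_to_B_add A_to_B_power intro!: sum_squares_add_square A_to_B_mem)

text \<open>\<open>1/s = s * (1/s)^2\<close>, and \<open>s\<close> is itself a sum of
  squares.\<close>

lemma inverse_denoms_sum_squares:
  assumes "s \<in> denoms V"
  shows "frac 1 s \<in> sum_squares (B_alg V)"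
proof -
  have "A_to_B s * frac 1 s ^ 2 \<in> sum_squares (B_alg V)"
    using assms by (intro B_alg.cone_mult A_to_B_sum_squares denoms_sum_squares
        square_in_sum_squares frac_mem_B_alg A_alg_one)
  then show ?thesis
    by (simp only: power2_eq_square mult.assoc[symmetric] A_to_B_mult_inverse[OF assms] mult_1)
qed

text \<open>\<open>h/s + (g/t)^2 = (h t^2 + g^2 s)/(s t^2)\<close>, and the numerator is a sum of
  squares because \<open>s\<close> is one.\<close>

lemma B_alg_sum_squares_frac:
  assumes "x \<in> sum_squares (B_alg V)"
  shows "\<exists>h \<in> sum_squares (A_alg V). \<exists>s \<in> denoms V. x = frac h s"
  using assms
proof (induction rule: sum_squares_induct)
  case zero
  show ?case
    by (rule bexI[of _ 0], rule bexI[of _ 1])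
       (auto intro: denoms.one simp flip: A_to_B_def)
next
  case (add_square x y)
  then obtain h s where h: "h \<in> sum_squares (A_alg V)" "s \<in> denoms V" "x = frac h s" by blast
  obtain g t where g: "g \<in> A_alg V" "t \<in> denoms V" "y = frac g t"
    using add_square by (auto elim: B_algE)
  have "x + y ^ 2 = frac (h * (t * t) + (g * g) * s) (s * (t * t))"
    using h g by (simp add: power2_eq_square frac_mult frac_add[of _ V _ V] denoms_mult)
  moreover have "h * (t * t) + (g * g) * s \<in> sum_squares (A_alg V)"
    using square_in_sum_squares[OF g(1)] denoms_sum_squares[OF g(2)] denoms_sum_squares[OF h(2)]
    by (intro sum_squares_add A_alg_sum_squares_mult[OF h(1)]
        A_alg_sum_squares_mult[of "t" V t] A_alg_sum_squares_mult[of "g * g" V s])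
       (simp_all add: power2_eq_square)
  ultimately show ?case using h g denoms_mult by metis
qed

text \<open>If \<open>g = h/s\<close> in \<open>B\<close>, then \<open>s g = h\<close> already in
  \<open>A\<close>, and \<open>s\<close> is a product of the required form.\<close>

lemma clear_denominators:
  assumes "finite V" "A_to_B g \<in> sum_squares (B_alg V)"
  obtains l :: "'i \<Rightarrow> nat"
  where "(\<Prod>i\<in>V. (1 + Var i ^ 2) ^ l i) * g \<in> sum_squares (A_alg V)"
proof -
  obtain h s where h: "h \<in> sum_squares (A_alg V)" "s \<in> denoms V" "A_to_B g = frac h s"
    using B_alg_sum_squares_frac[OF assms(2)] by blast
  have "s * g = h"
    using h(3) frac_eq_iff[OF denoms.one h(2)] by (simp add: A_to_B_def mult.commute)
  moreover obtain l where "s = (\<Prod>i\<in>V. (1 + Var i ^ 2) ^ l i)"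
    by (rule denoms_eq_prod[OF assms(1) h(2)])
  ultimately show ?thesis using that[of l] h(1) by simp
qed

section \<open>Monomials as products of variables\<close>

lemma Var_power: "Var i ^ k = Poly_Mapping.single (Poly_Mapping.single i k) 1"
  by (induction k) (auto simp: Var_def mult_single simp flip: single_add)

lemma prod_single:
  "(\<Prod>j\<in>J. Poly_Mapping.single (m j) 1) = Poly_Mapping.single (\<Sum>j\<in>J. m j) (1 :: real)"
  by (induction J rule: infinite_finite_induct) (auto simp: mult_single)

text \<open>The product runs over all of \<open>V\<close>, not only over the support of
  \<open>m\<close>, so that every monomial can absorb the same power of \<open>1/(1 + x^2)\<close>
  for each variable.\<close>

lemma single_eq_prod_Var:
  assumes "finite V" "Poly_Mapping.keys m \<subseteq> V"
  shows "Poly_Mapping.single m c = Poly_Mapping.single 0 c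
    * (\<Prod>i\<in>V. Var i ^ Poly_Mapping.lookup m i)"
proof -
  have "m = (\<Sum>i\<in>V. Poly_Mapping.single i (Poly_Mapping.lookup m i))"
    by (subst poly_mapping_sum_single, rule sum.mono_neutral_left)
       (use assms in \<open>auto simp: in_keys_iff\<close>)
  then show ?thesis
    by (simp add: Var_power prod_single mult_single)
qed

section \<open>Nonnegative polynomials\<close>

text \<open>In the coordinates \<open>u = 2x/(1 + x\<^sup>2)\<close>, \<open>v = (1 - x\<^sup>2)/(1 + x\<^sup>2)\<close> one has
  \<open>1/(1 + x\<^sup>2) = (1 + v)/2\<close> and \<open>x/(1 + x\<^sup>2) = u/2\<close>.  The exponent \<open>N\<close> exceeds all degrees of \<open>f\<close>,
  so the quotient vanishes at the points of the torus with some \<open>v\<^sub>i = -1\<close>; these correspond to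
  \<open>x\<^sub>i = \<infinity>\<close>.\<close>

theorem nonneg_approx_sum_squares:
  fixes f :: "'i mpoly"
  assumes V: "finite V" and f: "f \<in> A_alg V" and nonneg: "\<And>\<alpha>. 0 \<le> A_eval \<alpha> f"
  obtains q where "q \<in> A_alg V"
    "\<And>\<epsilon>. 0 < \<epsilon> \<Longrightarrow> A_to_B (f + \<epsilon> *\<^sub>R q) \<in> sum_squares (B_alg V)"
proof -
  define x :: "'i \<Rightarrow> 'i mfrac" where "x i = A_to_B (Var i)" for i
  define d :: "'i \<Rightarrow> 'i mfrac" where "d i = frac 1 (1 + Var i ^ 2)" for i
  define u where "u i = 2 * x i * d i" for i
  define v where "v i = (1 - x i ^ 2) * d i" for i
  let ?h = "of_real (1/2) :: 'i mfrac"
  have h: "?h + ?h = 1" by (metis of_real_add of_real_1 field_sum_of_halves)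
  have inv: "(1 + x i ^ 2) * d i = 1" for i
    using A_to_B_mult_inverse[OF one_plus_Var_sq_denoms[of i UNIV]]
    by (simp add: x_def d_def A_to_B_add A_to_B_power)
  have mem: "x i \<in> B_alg V" "d i \<in> B_alg V" if "i \<in> V" for i
    using that by (auto simp: x_def d_def intro!: A_to_B_mem frac_mem_B_alg A_alg_Var A_alg_one
        one_plus_Var_sq_denoms)
  interpret T: torus_coordinates "B_alg V" V u v
  proof
    show "u i \<in> B_alg V" "v i \<in> B_alg V" if "i \<in> V" for i
      using mem[OF that] B_alg.of_real_mem[of 2 V] unfolding u_def v_def power2_eq_square
      by (auto intro!: B_alg.add_mem B_alg.mult_mem B_alg.diff_mem)
    show "(u i)\<^sup>2 + (v i)\<^sup>2 = 1" for i
    proof -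
      have "(u i)\<^sup>2 + (v i)\<^sup>2 = ((1 + x i ^ 2) * d i)\<^sup>2"
        unfolding u_def v_def by (simp add: power2_eq_square algebra_simps)
      then show ?thesis by (simp add: inv)
    qed
  qed (rule V)
  have d_eq: "d i = ?h * (of_real 1 + v i)" for i
  proof -
    have "of_real 1 + v i = (1 + x i ^ 2) * d i + v i" by (simp add: inv)
    also have "\<dots> = d i + d i" by (simp add: v_def algebra_simps)
    finally have "?h * (of_real 1 + v i) = (?h + ?h) * d i"
      by (simp only: distrib_left distrib_right)
    then show ?thesis by (simp only: h mult_1)
  qed
  have xd_eq: "x i * d i = ?h * u i" for i
  proof -
    have "?h * u i = (?h + ?h) * (x i * d i)"
      unfolding u_def by (simp only: mult_2 distrib_left distrib_right mult.assoc)
    then show ?thesis by (simp only: h mult_1)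
  qed
  have repr: "T.represents (d i) (\<lambda>a b. 1/2 * (1 + b i))"
    "T.represents (x i * d i) (\<lambda>a b. 1/2 * a i)" if "i \<in> V" for i
  proof -
    show "T.represents (x i * d i) (\<lambda>a b. 1/2 * a i)"
      unfolding xd_eq using that by (intro T.represents_mult T.represents_const T.represents_coordinates)
    show "T.represents (d i) (\<lambda>a b. 1/2 * (1 + b i))"
      unfolding d_eq using that
      by (intro T.represents_mult T.represents_add T.represents_const T.represents_coordinates)
  qed
  let ?K = "Poly_Mapping.keys f" and ?c = "Poly_Mapping.lookup f"
  let ?e = "Poly_Mapping.lookup :: _ \<Rightarrow> 'i \<Rightarrow> nat"
  have keys: "Poly_Mapping.keys m \<subseteq> V" if "m \<in> ?K" for m
    using f that by (auto simp: A_alg_def vars_def)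
  define N where "N = Suc (\<Sum>m\<in>?K. \<Sum>i\<in>V. ?e m i)"
  have N: "?e m i \<le> N" if "m \<in> ?K" "i \<in> V" for m i
  proof -
    have "?e m i \<le> (\<Sum>i\<in>V. ?e m i)" using that V by (intro member_le_sum) auto
    also have "\<dots> \<le> (\<Sum>m\<in>?K. \<Sum>i\<in>V. ?e m i)"
      using that by (intro member_le_sum[of m ?K "\<lambda>m. \<Sum>i\<in>V. ?e m i"]) auto
    finally show ?thesis by (simp add: N_def)
  qed
  define E where "E = (\<Prod>i\<in>V. d i ^ N) * A_to_B f"
  \<comment> \<open>Distributing \<open>d i ^ N\<close> over a monomial leaves a polynomial in
    \<open>d i\<close> and \<open>x i * d i\<close>, both of which are represented on the
    torus.\<close>
  have split: "d i ^ N * x i ^ ?e m i = d i ^ (N - ?e m i) * (x i * d i) ^ ?e m i"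
    if "m \<in> ?K" "i \<in> V" for m i
  proof -
    have "d i ^ N = d i ^ (N - ?e m i) * d i ^ ?e m i"
      using N[OF that] by (simp flip: power_add)
    then show ?thesis by (simp add: power_mult_distrib mult_ac)
  qed
  have "A_to_B f = (\<Sum>m\<in>?K. A_to_B (Poly_Mapping.single m (?c m)))"
    by (subst poly_mapping_sum_single) (rule A_to_B_sum)
  also have "\<dots> = (\<Sum>m\<in>?K. of_real (?c m) * (\<Prod>i\<in>V. x i ^ ?e m i))"
    by (intro sum.cong refl)
       (simp add: single_eq_prod_Var[OF V keys] A_to_B_mult A_to_B_const A_to_B_prod
         A_to_B_power x_def)
  finally have "E = (\<Sum>m\<in>?K. of_real (?c m) * (\<Prod>i\<in>V. d i ^ N * x i ^ ?e m i))"
    by (simp add: E_def sum_distrib_left prod.distrib mult_ac)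
  also have "\<dots> = (\<Sum>m\<in>?K. of_real (?c m) * (\<Prod>i\<in>V. d i ^ (N - ?e m i) * (x i * d i) ^ ?e m i))"
    by (rule sum.cong[OF refl], rule arg_cong[of _ _ "(*) _"], rule prod.cong[OF refl], rule split)
  finally have E_repr: "T.represents E (\<lambda>a b. \<Sum>m\<in>?K. ?c m *
      (\<Prod>i\<in>V. (1/2 * (1 + b i)) ^ (N - ?e m i) * (1/2 * a i) ^ ?e m i))"
    by (simp only:) (intro T.represents_sum T.represents_mult T.represents_const T.represents_prod
        T.represents_power repr; assumption)
  have E_nonneg: "0 \<le> (\<Sum>m\<in>?K. ?c m *
      (\<Prod>i\<in>V. (1/2 * (1 + b i)) ^ (N - ?e m i) * (1/2 * a i) ^ ?e m i))"
    if ab: "(a, b) \<in> T.torus V" for a b :: "'i \<Rightarrow> real"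
  proof -
    have circle: "(a i)\<^sup>2 + (b i)\<^sup>2 = 1" if "i \<in> V" for i
      using ab that by (auto simp: T.torus_def)
    show ?thesis
    proof (cases "\<exists>i\<in>V. b i = -1")
      case True
      then obtain i where i: "i \<in> V" "b i = -1" "a i = 0"
        using circle by fastforce
      \<comment> \<open>For exponent 0 the first factor is \<open>0 ^ N\<close>, and
        \<open>N\<close> is a successor; for a positive exponent the factor \<open>a i = 0\<close>
        occurs.\<close>
      have "(1/2 * (1 + b i)) ^ (N - ?e m i) * (1/2 * a i) ^ ?e m i = 0" for m
        using i by (cases "?e m i = 0") (auto simp: N_def)
      then have "(\<Prod>i\<in>V. (1/2 * (1 + b i)) ^ (N - ?e m i) * (1/2 * a i) ^ ?e m i) = 0" for m
        using i(1) V by (intro prod_zero) blast+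
      then show ?thesis by (simp only: mult_zero_right sum.neutral_const order_refl)
    next
      case False
      \<comment> \<open>The inverse substitution \<open>x = u/(1 + v)\<close>: when no
        \<open>b i\<close> is \<open>-1\<close>, the torus function is a positive multiple of the
        value of \<open>f\<close> at \<open>y\<close>.\<close>
      define y where "y i = a i / (1 + b i)" for i
      have pos: "0 < 1 + b i" if "i \<in> V" for i
      proof -
        have "(b i)\<^sup>2 \<le> (a i)\<^sup>2 + (b i)\<^sup>2" by simp
        then have "\<bar>b i\<bar> \<le> 1" by (simp only: circle[OF that] abs_square_le_1)
        then show ?thesis using False that by (force simp: abs_le_iff)
      qed
      have point: "(1/2 * (1 + b i)) ^ (N - ?e m i) * (1/2 * a i) ^ ?e m i
          = (1/2 * (1 + b i)) ^ N * y i ^ ?e m i" if "m \<in> ?K" "i \<in> V" for m i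
      proof -
        have "(1 + b i) * y i = a i"
          using pos[OF that(2)] by (simp add: y_def)
        then have "1/2 * a i = (1/2 * (1 + b i)) * y i" by (simp only: mult.assoc)
        moreover have "(1/2 * (1 + b i)) ^ N
            = (1/2 * (1 + b i)) ^ (N - ?e m i) * (1/2 * (1 + b i)) ^ ?e m i"
          using N[OF that] by (simp flip: power_add)
        ultimately show ?thesis
          by (simp only: power_mult_distrib mult.assoc)
      qed
      have "(\<Sum>m\<in>?K. ?c m * (\<Prod>i\<in>V. (1/2 * (1 + b i)) ^ (N - ?e m i) * (1/2 * a i) ^ ?e m i))
          = (\<Sum>m\<in>?K. ?c m * (\<Prod>i\<in>V. (1/2 * (1 + b i)) ^ N * y i ^ ?e m i))"
        by (rule sum.cong[OF refl], rule arg_cong[of _ _ "(*) _"], rule prod.cong[OF refl], rule point)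
      also have "\<dots> = (\<Prod>i\<in>V. (1/2 * (1 + b i)) ^ N) * A_eval y f"
        unfolding A_eval_def
        by (simp add: sum_distrib_left prod.distrib monom_eval_superset[OF V keys] mult_ac)
      also have "\<dots> \<ge> 0"
        using pos nonneg by (intro mult_nonneg_nonneg prod_nonneg) (auto simp: less_imp_le)
      finally show ?thesis .
    qed
  qed
  \<comment> \<open>\<open>q\<close> clears the denominators of \<open>E\<close>, so
    \<open>q * (E + \<epsilon>)\<close> is \<open>f + \<epsilon> q\<close>; being a denominator,
    \<open>q\<close> is a sum of squares.\<close>
  define q where "q = (\<Prod>i\<in>V. (1 + Var i ^ 2) ^ N :: 'i mpoly)"
  have q: "q \<in> denoms V"
    unfolding q_def by (intro denoms_prod denoms_power one_plus_Var_sq_denoms)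
  have "A_to_B q * (\<Prod>i\<in>V. d i ^ N) = (\<Prod>i\<in>V. ((1 + x i ^ 2) * d i) ^ N)"
    by (simp add: q_def A_to_B_prod A_to_B_power A_to_B_add x_def power_mult_distrib prod.distrib)
  then have qd: "A_to_B q * (\<Prod>i\<in>V. d i ^ N) = 1" by (simp add: inv)
  show ?thesis
  proof (rule that[of q])
    show "q \<in> A_alg V" using q by (rule denoms_subset_A_alg)
    fix \<epsilon> :: real assume "0 < \<epsilon>"
    then have "A_to_B q * (E + of_real \<epsilon>) \<in> sum_squares (B_alg V)"
      using T.represents_nonneg[OF E_repr E_nonneg] denoms_sum_squares[OF q]
      by (intro B_alg.cone_mult A_to_B_sum_squares)
    also have "A_to_B q * (E + of_real \<epsilon>)
        = (A_to_B q * (\<Prod>i\<in>V. d i ^ N)) * A_to_B f + of_real \<epsilon> * A_to_B q"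
      by (simp add: E_def algebra_simps)
    finally show "A_to_B (f + \<epsilon> *\<^sub>R q) \<in> sum_squares (B_alg V)"
      by (simp only: qd mult_1 A_to_B_add A_to_B_scaleR scaleR_conv_of_real)
  qed
qed

text \<open>Only small \<open>\<epsilon> > 0\<close> are assumed, since the variables of
  \<open>f + \<epsilon> q\<close> are controlled only for those.\<close>

lemma nonneg_if_eventually_nonneg_perturbation:
  fixes a b :: real
  assumes "\<forall>\<^sub>F \<epsilon> in at_right 0. 0 \<le> a + \<epsilon> * b"
  shows "0 \<le> a"
proof (rule tendsto_lowerbound[OF _ assms])
  show "((\<lambda>\<epsilon>. a + \<epsilon> * b) \<longlongrightarrow> a) (at_right 0)"
    by (auto intro!: tendsto_eq_intros)
qed simp

text \<open>The finitely many nonzero coefficients of \<open>f\<close> survive a small perturbation.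
  The third condition ties the multiplier to the variables of the polynomial tested, so none may be
  lost.\<close>

lemma eventually_vars_subset_perturbation:
  "\<forall>\<^sub>F \<epsilon> in at_right 0. vars f \<subseteq> vars (f + \<epsilon> *\<^sub>R q)"
proof -
  have "\<forall>\<^sub>F \<epsilon> in at_right 0. Poly_Mapping.lookup (f + \<epsilon> *\<^sub>R q) m \<noteq> 0"
    if "m \<in> Poly_Mapping.keys f" for m
  proof -
    have "Poly_Mapping.lookup (\<epsilon> *\<^sub>R q) m = \<epsilon> * Poly_Mapping.lookup q m" for \<epsilon>
    proof -
      have "Poly_Mapping.single 0 \<epsilon> * q = Poly_Mapping.map ((*) \<epsilon>) q"
        by (simp add: mult_map_scale_conv_mult)
      then show ?thesis
        by (simp add: scaleR_poly_mapping_eq map.rep_eq when_def)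
    qed
    then have "((\<lambda>\<epsilon>. Poly_Mapping.lookup (f + \<epsilon> *\<^sub>R q) m) \<longlongrightarrow> Poly_Mapping.lookup f m) (at_right 0)"
      by (auto simp: lookup_add intro!: tendsto_eq_intros)
    then show ?thesis
      using that by (intro tendsto_imp_eventually_ne) (auto simp: in_keys_iff)
  qed
  then have "\<forall>\<^sub>F \<epsilon> in at_right 0. \<forall>m\<in>Poly_Mapping.keys f. Poly_Mapping.lookup (f + \<epsilon> *\<^sub>R q) m \<noteq> 0"
    by (intro eventually_ball_finite) auto
  then show ?thesis
    unfolding vars_def in_keys_iff[symmetric] by (rule eventually_mono) blast
qed

section \<open>Linear functionals\<close>

lemma linear_functional_onD:
  assumes "linear_functional_on D L"
  shows "x \<in> D \<Longrightarrow> y \<in> D \<Longrightarrow> L (x + y) = L x + L y" "x \<in> D \<Longrightarrow> L (c *\<^sub>R x) = c * L x"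
  using assms by (auto simp: linear_functional_on_def)

text \<open>Zorn's lemma for graphs of partial extensions. A maximal one is total, because
  cofinality leaves room for a value at one further vector.\<close>

theorem Riesz_extension:
  fixes U W P :: "'v::real_vector set"
  assumes U: "subspace U" "U \<subseteq> W" and W: "subspace W"
    and P: "0 \<in> P" "\<And>x y. x \<in> P \<Longrightarrow> y \<in> P \<Longrightarrow> x + y \<in> P"
      "\<And>c x. 0 < c \<Longrightarrow> x \<in> P \<Longrightarrow> c *\<^sub>R x \<in> P"
    and cofinal: "\<And>w. w \<in> W \<Longrightarrow> \<exists>x\<in>U. x - w \<in> P"
    and L: "linear_functional_on U L" "\<And>x. x \<in> U \<Longrightarrow> x \<in> P \<Longrightarrow> 0 \<le> L x"
  obtains L' where "linear_functional_on W L'" "\<And>x. x \<in> U \<Longrightarrow> L' x = L x"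
    "\<And>x. x \<in> W \<Longrightarrow> x \<in> P \<Longrightarrow> 0 \<le> L' x"
proof -
  let ?G0 = "(\<lambda>x. (x, L x)) ` U"
  \<comment> \<open>Graphs are subspaces of pairs (vector, value). That they are single-valued is
    not demanded: it follows from positivity at \<open>0 \<in> P\<close>.\<close>
  define \<G> where "\<G> = {G. subspace G \<and> fst ` G \<subseteq> W \<and> ?G0 \<subseteq> G \<and> (\<forall>(x, r)\<in>G. x \<in> P \<longrightarrow> 0 \<le> r)}"
  have "subspace ?G0"
  proof (rule subspaceI)
    show "0 \<in> ?G0"
      using subspace_0[OF U(1)] linear_functional_onD(2)[OF L(1), of 0 0] by (force simp: zero_prod_def)
  qed (auto simp: linear_functional_onD[OF L(1)] subspace_add[OF U(1)] subspace_scale[OF U(1)]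
      intro!: image_eqI)
  then have "?G0 \<in> \<G>" using U L by (auto simp: \<G>_def)
  have "\<exists>M\<in>\<G>. \<forall>X\<in>\<G>. M \<subseteq> X \<longrightarrow> X = M"
  proof (rule subset_Zorn_nonempty)
    fix \<C> assume \<C>: "\<C> \<noteq> {}" "subset.chain \<G> \<C>"
    have dir: "\<exists>G\<in>\<C>. x \<in> G \<and> y \<in> G" if "x \<in> \<Union>\<C>" "y \<in> \<Union>\<C>" for x y
      using that \<C>(2) unfolding subset_chain_def by blast
    have sub: "subspace G" if "G \<in> \<C>" for G
      using that \<C>(2) unfolding subset_chain_def \<G>_def by blast
    have "subspace (\<Union>\<C>)"
    proof (rule subspaceI)
      show "0 \<in> \<Union>\<C>" using \<C>(1) sub subspace_0 by blast
      show "x + y \<in> \<Union>\<C>" if "x \<in> \<Union>\<C>" "y \<in> \<Union>\<C>" for x y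
        using dir[OF that] sub subspace_add by blast
      show "c *\<^sub>R x \<in> \<Union>\<C>" if "x \<in> \<Union>\<C>" for c x
        using that sub subspace_scale by blast
    qed
    then show "\<Union>\<C> \<in> \<G>"
      using \<C> unfolding subset_chain_def \<G>_def by blast
  qed (use \<open>?G0 \<in> \<G>\<close> in blast)
  then obtain M where "M \<in> \<G>" and max: "\<And>X. X \<in> \<G> \<Longrightarrow> M \<subseteq> X \<Longrightarrow> X = M" by blast
  then have M: "subspace M" "fst ` M \<subseteq> W" "?G0 \<subseteq> M"
    and M_pos: "\<And>x r. (x, r) \<in> M \<Longrightarrow> x \<in> P \<Longrightarrow> 0 \<le> r"
    by (auto simp: \<G>_def)
  have M_diff: "(x - x', r - r') \<in> M" if "(x, r) \<in> M" "(x', r') \<in> M" for x x' r r'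
    using subspace_diff[OF M(1) that] by simp
  have M_scale: "(c *\<^sub>R x, c * r) \<in> M" if "(x, r) \<in> M" for c x r
    using subspace_scale[OF M(1) that, of c] by simp
  have total: "\<exists>r. (y, r) \<in> M" if y: "y \<in> W" for y
  proof -
    \<comment> \<open>In the order given by \<open>P\<close>, \<open>S\<close> holds the values at
      elements below \<open>y\<close> and \<open>T\<close> those at elements above; a value at
      \<open>y\<close> has to separate them.\<close>
    define S where "S = {r. \<exists>x. (x, r) \<in> M \<and> y - x \<in> P}"
    define T where "T = {r. \<exists>x. (x, r) \<in> M \<and> x - y \<in> P}"
    have ST: "s \<le> t" if st: "s \<in> S" "t \<in> T" for s t
    proof -
      obtain x x' where *: "(x, s) \<in> M" "y - x \<in> P" "(x', t) \<in> M" "x' - y \<in> P"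
        using st unfolding S_def T_def by blast
      then have "x' - x \<in> P" using P(2)[OF *(2,4)] by simp
      then show ?thesis using M_pos[OF M_diff[OF *(3,1)]] by simp
    qed
    obtain z where "z \<in> U" "z - y \<in> P" using cofinal[OF y] by blast
    then have "L z \<in> T" using M(3) by (auto simp: T_def)
    \<comment> \<open>The negative of an element above \<open>- y\<close> lies below
      \<open>y\<close>, so \<open>S\<close> is nonempty.\<close>
    obtain z' where z': "z' \<in> U" "z' - (- y) \<in> P"
      using cofinal[of "- y"] subspace_neg[OF W y] by blast
    then have "(- z', L (- z')) \<in> M" "y - (- z') \<in> P"
      using M(3) subspace_neg[OF U(1)] by (auto simp: add.commute)
    then have "S \<noteq> {}" unfolding S_def by blast
    define t where "t = Sup S"
    have S_t: "s \<le> t" if "s \<in> S" for s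
      unfolding t_def using that ST[OF _ \<open>L z \<in> T\<close>] by (intro cSup_upper bdd_aboveI)
    have t_T: "t \<le> r" if "r \<in> T" for r
      unfolding t_def using that \<open>S \<noteq> {}\<close> ST by (intro cSup_least) auto
    let ?M = "span (insert (y, t) M)"
    have "?M \<in> \<G>"
      unfolding \<G>_def
    proof (intro CollectI conjI)
      show "?G0 \<subseteq> ?M" using M(3) span_superset[of "insert (y, t) M"] by blast
      have decomp: "\<exists>k x s. z = x + k *\<^sub>R y \<and> r = s + k * t \<and> (x, s) \<in> M"
        if zr: "(z, r) \<in> ?M" for z r
      proof -
        have "span M = M" using M(1) by simp
        then obtain k where "(z, r) - k *\<^sub>R (y, t) \<in> M"
          using zr unfolding span_breakdown_eq by metis
        then show ?thesis
          by (intro exI[of _ k] exI[of _ "z - k *\<^sub>R y"] exI[of _ "r - k * t"]) simp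
      qed
      show "fst ` ?M \<subseteq> W"
      proof clarify
        fix z r assume "(z, r) \<in> ?M"
        from decomp[OF this] obtain k x s where *: "z = x + k *\<^sub>R y" "(x, s) \<in> M" by blast
        then have "x \<in> W" using M(2) by force
        then show "fst (z, r) \<in> W"
          using * y by (simp add: subspace_add[OF W] subspace_scale[OF W])
      qed
      show "\<forall>(z, r)\<in>?M. z \<in> P \<longrightarrow> 0 \<le> r"
      proof clarify
        fix z r assume "(z, r) \<in> ?M" and "z \<in> P"
        from decomp[OF this(1)] obtain k x s
          where *: "z = x + k *\<^sub>R y" "r = s + k * t" "(x, s) \<in> M" by blast
        \<comment> \<open>Division by \<open>|k|\<close> makes the coefficient of \<open>y\<close>
          equal to 1 or -1, which reduces the claim to a comparison of \<open>t\<close> with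
          \<open>S\<close> or \<open>T\<close>.\<close>
        consider "k = 0" | "0 < k" | "k < 0" by linarith
        then show "0 \<le> r"
        proof cases
          case 1
          then show ?thesis using * \<open>z \<in> P\<close> M_pos by simp
        next
          case 2
          then have "(1 / k) *\<^sub>R (x + k *\<^sub>R y) \<in> P" using P(3)[of "1 / k"] * \<open>z \<in> P\<close> by simp
          then have "y - (- 1 / k) *\<^sub>R x \<in> P"
            using 2 by (simp add: scaleR_add_right add.commute)
          then have "(- 1 / k) * s \<in> S" using M_scale[OF *(3), of "- 1 / k"] by (auto simp: S_def)
          from S_t[OF this] show ?thesis using 2 * by (simp add: field_simps)
        next
          case 3
          then have "(- 1 / k) *\<^sub>R (x + k *\<^sub>R y) \<in> P" using P(3)[of "- 1 / k"] * \<open>z \<in> P\<close> by simp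
          then have "(- 1 / k) *\<^sub>R x - y \<in> P"
            using 3 by (simp add: scaleR_add_right)
          then have "(- 1 / k) * s \<in> T" using M_scale[OF *(3), of "- 1 / k"] by (auto simp: T_def)
          from t_T[OF this] show ?thesis using 3 * by (simp add: field_simps)
        qed
      qed
    qed (rule subspace_span)
    moreover have "M \<subseteq> ?M" "(y, t) \<in> ?M"
      using span_superset[of "insert (y, t) M"] by auto
    ultimately show ?thesis using max by blast
  qed
  have unique: "r = r'" if "(x, r) \<in> M" "(x, r') \<in> M" for x r r'
    using M_pos[OF M_diff[OF that]] M_pos[OF M_diff[OF that(2,1)]] P(1) by simp
  define L' where "L' x = (THE r. (x, r) \<in> M)" for x
  have L'_eq: "L' x = r" if "(x, r) \<in> M" for x r
    unfolding L'_def using that unique by blast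
  have L'_M: "(x, L' x) \<in> M" if "x \<in> W" for x
    using total[OF that] L'_eq by auto
  show ?thesis
  proof (rule that[of L'])
    show "linear_functional_on W L'"
      unfolding linear_functional_on_def
      using subspace_add[OF M(1) L'_M L'_M] M_scale[OF L'_M] by (auto intro!: L'_eq)
    show "L' x = L x" if "x \<in> U" for x
      using that M(3) by (intro L'_eq) auto
    show "0 \<le> L' x" if "x \<in> W" "x \<in> P" for x
      using M_pos[OF L'_M[OF that(1)] that(2)] .
  qed
qed

text \<open>For \<open>x = f/s\<close> the numerator is nonnegative, and
  \<open>(f + \<epsilon> q)/s\<close> is a sum of squares because \<open>1/s\<close> is one. Apply
  \<open>L\<close> and let \<open>\<epsilon>\<close> tend to 0.\<close>

lemma psd_imp_positive_on_B:
  assumes L: "linear_functional_on (B_alg \<Omega>) L" and psd: "psd_on (B_alg \<Omega>) L"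
  shows "positive_on_B \<Omega> L"
  unfolding positive_on_B_def
proof (intro ballI impI)
  fix x assume x: "x \<in> B_alg \<Omega>" and nonneg: "\<forall>\<alpha> \<in> \<Omega> \<rightarrow>\<^sub>E UNIV. 0 \<le> B_eval \<alpha> x"
  obtain f s where fs: "f \<in> A_alg \<Omega>" "s \<in> denoms \<Omega>" "x = frac f s"
    using x by (rule B_algE)
  have "0 \<le> A_eval \<alpha> f" for \<alpha>
  proof -
    have "0 \<le> A_eval (restrict \<alpha> \<Omega>) f / A_eval (restrict \<alpha> \<Omega>) s"
      using nonneg fs(3) by (simp add: B_eval_frac[OF denoms_UNIV[OF fs(2)]])
    then show ?thesis
      using A_eval_denoms_pos[OF fs(2), of "restrict \<alpha> \<Omega>"]
      by (simp add: A_eval_restrict[OF fs(1)] zero_le_divide_iff)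
  qed
  \<comment> \<open>The approximation is made over the finite set \<open>vars f\<close>, since
    \<open>\<Omega>\<close> may be infinite.\<close>
  then obtain q where q: "q \<in> A_alg (vars f)"
    "\<And>\<epsilon>. 0 < \<epsilon> \<Longrightarrow> A_to_B (f + \<epsilon> *\<^sub>R q) \<in> sum_squares (B_alg (vars f))"
    using nonneg_approx_sum_squares[of "vars f" f] by (auto simp: A_alg_def)
  have sub: "vars f \<subseteq> \<Omega>" using fs(1) by (simp add: A_alg_def)
  define z where "z = A_to_B q * frac 1 s"
  have z: "z \<in> B_alg \<Omega>"
    unfolding z_def using q(1) A_alg_mono[OF sub] fs(2)
    by (intro B_alg_mult A_to_B_mem frac_mem_B_alg A_alg_one) auto
  have step: "0 \<le> L x + \<epsilon> * L z" if "0 < \<epsilon>" for \<epsilon>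
  proof -
    have "A_to_B (f + \<epsilon> *\<^sub>R q) * frac 1 s \<in> sum_squares (B_alg \<Omega>)"
      using q(2)[OF that] sum_squares_mono[OF B_alg_mono[OF sub]]
      by (intro B_alg.cone_mult inverse_denoms_sum_squares fs) auto
    also have "A_to_B (f + \<epsilon> *\<^sub>R q) * frac 1 s = x + \<epsilon> *\<^sub>R z"
      by (simp add: z_def fs(3) frac_eq_mult[OF fs(2), of f] A_to_B_add A_to_B_scaleR distrib_right)
    finally have "0 \<le> L (x + \<epsilon> *\<^sub>R z)" using psd by (simp add: psd_on_def)
    then show ?thesis
      using x z by (simp add: linear_functional_onD[OF L] subspace_scale[OF subspace_B_alg])
  qed
  have "\<forall>\<^sub>F \<epsilon> in at_right 0. 0 \<le> L x + \<epsilon> * L z"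
    using eventually_at_right_less[of 0] by eventually_elim (rule step)
  then show "0 \<le> L x" by (rule nonneg_if_eventually_nonneg_perturbation)
qed

lemma positive_imp_psd_on_B: "positive_on_B \<Omega> L \<Longrightarrow> psd_on (B_alg \<Omega>) L"
  using B_eval_sum_squares_nonneg by (force simp: positive_on_B_def psd_on_def)

lemma positive_on_B_imp_positive_on_A:
  assumes "extends_to_B \<Omega> L L'" "positive_on_B \<Omega> L'"
  shows "positive_on_A \<Omega> L"
  unfolding positive_on_A_def
proof (intro ballI impI)
  fix f assume f: "f \<in> A_alg \<Omega>" "\<forall>\<alpha> \<in> \<Omega> \<rightarrow>\<^sub>E UNIV. 0 \<le> A_eval \<alpha> f"
  then have "0 \<le> L' (A_to_B f)"
    using assms(2) A_to_B_mem[OF f(1)] by (simp add: positive_on_B_def)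
  then show "0 \<le> L f" using assms(1) f(1) by (simp add: extends_to_B_def)
qed

text \<open>Riesz extension for the cone of pointwise nonnegative fractions; polynomials are cofinal
  because \<open>f/s <= |f| <= f^2 + 1\<close>.\<close>

lemma positive_on_A_extends:
  assumes L: "linear_functional_on (A_alg \<Omega>) L" and pos: "positive_on_A \<Omega> L"
  obtains L' where "extends_to_B \<Omega> L L'" "positive_on_B \<Omega> L'"
proof -
  define P where "P = {x \<in> B_alg \<Omega>. \<forall>\<alpha> \<in> \<Omega> \<rightarrow>\<^sub>E UNIV. 0 \<le> B_eval \<alpha> x}"
  \<comment> \<open>The subspace to extend from is the image of \<open>A\<close> in
    \<open>B\<close>, so \<open>L\<close> is transported along the embedding.\<close>
  define L\<^sub>0 where "L\<^sub>0 = L \<circ> the_inv A_to_B"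
  have inj: "inj (A_to_B :: 'a mpoly \<Rightarrow> 'a mfrac)" by (rule injI) (rule inj_A_to_B)
  have L\<^sub>0: "L\<^sub>0 (A_to_B f) = L f" for f by (simp add: L\<^sub>0_def the_inv_f_f[OF inj])
  have "linear (A_to_B :: 'a mpoly \<Rightarrow> _)" by (rule linearI) (simp_all add: A_to_B_add A_to_B_scaleR)
  obtain L' where L': "linear_functional_on (B_alg \<Omega>) L'"
    "\<And>x. x \<in> A_to_B ` A_alg \<Omega> \<Longrightarrow> L' x = L\<^sub>0 x" "\<And>x. x \<in> B_alg \<Omega> \<Longrightarrow> x \<in> P \<Longrightarrow> 0 \<le> L' x"
  proof (rule Riesz_extension[of "A_to_B ` A_alg \<Omega>" "B_alg \<Omega>" P L\<^sub>0])
    show "subspace (A_to_B ` A_alg \<Omega>)"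
      using \<open>linear A_to_B\<close> subspace_A_alg by (rule linear_subspace_image)
    show "A_to_B ` A_alg \<Omega> \<subseteq> B_alg \<Omega>" by (auto intro: A_to_B_mem)
    show "subspace (B_alg \<Omega>)" by (rule subspace_B_alg)
    show "0 \<in> P"
      by (simp add: P_def subspace_0[OF subspace_B_alg] B_eval_A_to_B[of _ 0, simplified])
    show "x + y \<in> P" if "x \<in> P" "y \<in> P" for x y
      using that by (auto simp: P_def B_alg_add B_eval_add)
    show "c *\<^sub>R x \<in> P" if "0 < c" "x \<in> P" for c x
      using that by (auto simp: P_def subspace_scale[OF subspace_B_alg] B_eval_scaleR)
    show "linear_functional_on (A_to_B ` A_alg \<Omega>) L\<^sub>0"
      using linear_functional_onD[OF L]
      by (auto simp: linear_functional_on_def L\<^sub>0 simp flip: A_to_B_add A_to_B_scaleR)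
    show "0 \<le> L\<^sub>0 x" if "x \<in> A_to_B ` A_alg \<Omega>" "x \<in> P" for x
      using that pos by (auto simp: P_def positive_on_A_def L\<^sub>0)
  next
    fix w assume w: "w \<in> B_alg \<Omega>"
    obtain f s where fs: "f \<in> A_alg \<Omega>" "s \<in> denoms \<Omega>" "w = frac f s"
      using w by (rule B_algE)
    have mem: "f ^ 2 + 1 \<in> A_alg \<Omega>" by (intro A_alg_add A_alg_power A_alg_one fs)
    have "0 \<le> B_eval \<alpha> (A_to_B (f ^ 2 + 1) - w)" for \<alpha>
    proof -
      have "A_eval \<alpha> f / A_eval \<alpha> s \<le> \<bar>A_eval \<alpha> f\<bar> / A_eval \<alpha> s"
        using A_eval_denoms_pos[OF fs(2), of \<alpha>] by (intro divide_right_mono) auto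
      also have "\<dots> \<le> \<bar>A_eval \<alpha> f\<bar> / 1"
        using A_eval_denoms_ge_1[OF fs(2), of \<alpha>] by (intro divide_left_mono) auto
      also have "\<dots> \<le> (A_eval \<alpha> f)\<^sup>2 + 1"
        using sum_squares_bound[of "\<bar>A_eval \<alpha> f\<bar>" 1] by simp
      finally have "A_eval \<alpha> f / A_eval \<alpha> s \<le> A_eval \<alpha> (f ^ 2 + 1)"
        by (simp add: A_eval_add A_eval_power)
      moreover have "B_eval \<alpha> (A_to_B (f ^ 2 + 1) + (-1) *\<^sub>R w)
          = A_eval \<alpha> (f ^ 2 + 1) - A_eval \<alpha> f / A_eval \<alpha> s"
        using A_to_B_mem[OF mem] w subspace_scale[OF subspace_B_alg w]
        by (simp only: B_eval_add B_eval_scaleR B_eval_A_to_B) (simp add: fs B_eval_frac[OF denoms_UNIV[OF fs(2)]])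
      ultimately show ?thesis by simp
    qed
    then show "\<exists>x\<in>A_to_B ` A_alg \<Omega>. x - w \<in> P"
      using mem w by (intro bexI[of _ "A_to_B (f ^ 2 + 1)"])
        (auto simp: P_def intro!: subspace_diff[OF subspace_B_alg] A_to_B_mem)
  qed (rule that)
  show ?thesis
  proof (rule that[of L'])
    show "extends_to_B \<Omega> L L'" using L' by (simp add: extends_to_B_def L\<^sub>0)
    show "positive_on_B \<Omega> L'" using L'(3) by (simp add: positive_on_B_def P_def)
  qed
qed

text \<open>A multiplier is strictly positive everywhere, so a sum of squares \<open>p f\<close>
  forces \<open>f\<close> to be nonnegative. Conversely, for small \<open>\<epsilon>\<close> some
  multiplier in the variables of \<open>f\<close> makes \<open>f + \<epsilon> q\<close> a sum of
  squares, and \<open>\<epsilon>\<close> tends to 0.\<close>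

theorem positive_on_A_iff_denominators:
  assumes L: "linear_functional_on (A_alg \<Omega>) L"
  shows "positive_on_A \<Omega> L \<longleftrightarrow>
    (\<forall>f \<in> A_alg \<Omega>. \<forall>l :: 'i \<Rightarrow> nat.
      (\<Prod>i \<in> vars f. (1 + Var i ^ 2) ^ l i) * f \<in> sum_squares (A_alg \<Omega>) \<longrightarrow> 0 \<le> L f)"
proof (intro iffI ballI allI impI)
  fix f and l :: "'i \<Rightarrow> nat"
  let ?p = "\<Prod>i \<in> vars f. (1 + Var i ^ 2) ^ l i :: 'i mpoly"
  assume pos: "positive_on_A \<Omega> L" and f: "f \<in> A_alg \<Omega>" "?p * f \<in> sum_squares (A_alg \<Omega>)"
  have "?p \<in> denoms UNIV" by (intro denoms_prod denoms_power one_plus_Var_sq_denoms) simp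
  then have "0 \<le> A_eval \<alpha> f" for \<alpha>
    using A_eval_sum_squares_nonneg[OF f(2), of \<alpha>] A_eval_denoms_pos[of ?p UNIV \<alpha>]
    by (simp add: A_eval_mult zero_le_mult_iff)
  then show "0 \<le> L f" using pos f(1) by (simp add: positive_on_A_def)
next
  assume hyp: "\<forall>f \<in> A_alg \<Omega>. \<forall>l :: 'i \<Rightarrow> nat.
      (\<Prod>i \<in> vars f. (1 + Var i ^ 2) ^ l i) * f \<in> sum_squares (A_alg \<Omega>) \<longrightarrow> 0 \<le> L f"
  show "positive_on_A \<Omega> L"
    unfolding positive_on_A_def
  proof (intro ballI impI)
    fix f assume f: "f \<in> A_alg \<Omega>" and nonneg: "\<forall>\<alpha> \<in> \<Omega> \<rightarrow>\<^sub>E UNIV. 0 \<le> A_eval \<alpha> f"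
    have "0 \<le> A_eval \<alpha> f" for \<alpha>
      using nonneg A_eval_restrict[OF f, of \<alpha>] by (metis restrict_PiE_iff UNIV_I)
    then obtain q where q: "q \<in> A_alg (vars f)"
      "\<And>\<epsilon>. 0 < \<epsilon> \<Longrightarrow> A_to_B (f + \<epsilon> *\<^sub>R q) \<in> sum_squares (B_alg (vars f))"
      using nonneg_approx_sum_squares[of "vars f" f] by (auto simp: A_alg_def)
    have sub: "vars f \<subseteq> \<Omega>" using f by (simp add: A_alg_def)
    have q\<Omega>: "q \<in> A_alg \<Omega>" using q(1) A_alg_mono[OF sub] by auto
    have step: "0 \<le> L f + \<epsilon> * L q" if \<epsilon>: "0 < \<epsilon>" "vars f \<subseteq> vars (f + \<epsilon> *\<^sub>R q)" for \<epsilon>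
    proof -
      let ?g = "f + \<epsilon> *\<^sub>R q"
      have "?g \<in> A_alg (vars f)"
        using q(1) by (intro A_alg_add A_alg_scaleR) (auto simp: A_alg_def)
      \<comment> \<open>\<open>q\<close> brings in no new variable and this
        \<open>\<epsilon>\<close> loses none, so the multiplier has exactly the variables allowed
        for \<open>?g\<close>.\<close>
      then have vars: "vars ?g = vars f" using \<epsilon>(2) by (auto simp: A_alg_def)
      obtain l where "(\<Prod>i\<in>vars f. (1 + Var i ^ 2) ^ l i) * ?g \<in> sum_squares (A_alg (vars f))"
        by (rule clear_denominators[OF finite_vars q(2)[OF \<epsilon>(1)]])
      then have "(\<Prod>i\<in>vars ?g. (1 + Var i ^ 2) ^ l i) * ?g \<in> sum_squares (A_alg \<Omega>)"
        using sum_squares_mono[OF A_alg_mono[OF sub]] by (auto simp: vars)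
      then have "0 \<le> L ?g"
        using hyp f q\<Omega> by (blast intro: A_alg_add A_alg_scaleR)
      then show ?thesis
        using f q\<Omega> by (simp add: linear_functional_onD[OF L] A_alg_scaleR)
    qed
    have "\<forall>\<^sub>F \<epsilon> in at_right 0. 0 \<le> L f + \<epsilon> * L q"
      using eventually_vars_subset_perturbation[of f q] eventually_at_right_less[of 0]
      by eventually_elim (rule step)
    then show "0 \<le> L f" by (rule nonneg_if_eventually_nonneg_perturbation)
  qed
qed

theorem proposition3p4:
  fixes \<Omega> :: "'i set" and L :: "'i mpoly \<Rightarrow> real"
  assumes "linear_functional_on (A_alg \<Omega>) L"
  shows "(positive_on_A \<Omega> L \<longleftrightarrow> (\<exists>L'. extends_to_B \<Omega> L L' \<and> positive_on_B \<Omega> L')) \<and>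
         (positive_on_A \<Omega> L \<longleftrightarrow> (\<exists>L'. extends_to_B \<Omega> L L' \<and> psd_on (B_alg \<Omega>) L')) \<and>
         (positive_on_A \<Omega> L \<longleftrightarrow>
            (\<forall>f \<in> A_alg \<Omega>. \<forall>l :: 'i \<Rightarrow> nat.
               (\<Prod>i \<in> vars f. (1 + Var i ^ 2) ^ l i) * f \<in> sum_squares (A_alg \<Omega>) \<longrightarrow> 0 \<le> L f))"
proof -
  have 1: "positive_on_A \<Omega> L \<longleftrightarrow> (\<exists>L'. extends_to_B \<Omega> L L' \<and> positive_on_B \<Omega> L')"
    (is "_ \<longleftrightarrow> ?ext")
  proof
    assume "positive_on_A \<Omega> L"
    then obtain L' where "extends_to_B \<Omega> L L'" "positive_on_B \<Omega> L'"
      by (rule positive_on_A_extends[OF assms])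
    then show ?ext by blast
  qed (blast intro: positive_on_B_imp_positive_on_A)
  have "positive_on_B \<Omega> L' \<longleftrightarrow> psd_on (B_alg \<Omega>) L'" if "extends_to_B \<Omega> L L'" for L'
    using that psd_imp_positive_on_B positive_imp_psd_on_B by (auto simp: extends_to_B_def)
  then have "positive_on_A \<Omega> L \<longleftrightarrow> (\<exists>L'. extends_to_B \<Omega> L L' \<and> psd_on (B_alg \<Omega>) L')"
    using 1 by blast
  then show ?thesis using 1 positive_on_A_iff_denominators[OF assms] by blast
qed

end
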